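(* Let $J$ be a bounded Jacobi operator on $\ell^2(\mathbb{Z})$ and let $Q$ be the projection-valued measure on $[0,\pi)$ associated with $J$ (defined in the context). Let $a,b\in(0,\frac{\pi}{2})$ and let $\mathcal{F}=\operatorname{span}(\mathcal{F}_1\cup\mathcal{F}_2\cup\mathcal{F}_3)\subseteq C(\mathbb{R})$, where $$\mathcal{F}_1=\{x^n:n\in\mathbb{N}\},\quad \mathcal{F}_2=\{e^{itx}:t\in\mathbb{R}\},\quad \mathcal{F}_3=\{(x-z)^{-1}:z\in\mathbb{C},\ \operatorname{Im}z>0\}.$$ For any $F\in\mathcal{F}$ there exists $\gamma>0$ such that for any $a\le\alpha<\beta\le b$, any $\psi\in\mathcal{H}_+$ and any $\theta\in[\alpha,\beta)$, $$\big\|F(J_\theta)Q([\alpha,\beta))\psi-F(J)Q([\alpha,\beta))\psi\big\|<\gamma|\beta-\alpha|\,\big\|Q([\alpha,\beta))\psi\big\|.$$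
   Context: A bounded Jacobi operator $J$ on $\ell^2(\mathbb{Z})$ is $(J\psi)(n)=a_{n-1}\psi(n-1)+a_n\psi(n+1)+b_n\psi(n)$, with $(a_n),(b_n)$ bounded real sequences and $a_n>0$ for all $n\in\mathbb{Z}$. $P$ is its spectral measure, $\mu_\psi(B)=\langle P(B)\psi,\psi\rangle$, $\mu_{kj}(B)=\langle P(B)\delta_k,\delta_j\rangle$, $\mu=\mu_{\delta_0}+\mu_{\delta_1}$, and $\mu_s$ is the part of $\mu$ singular with respect to Lebesgue measure. $M_{kj}(z)=\int\frac{d\mu_{kj}(E)}{E-z}$ and $M(z)=\int\frac{d\mu(E)}{E-z}$ for $\operatorname{Im}z>0$. $\mathcal{H}_+=\{\psi\in\ell^2(\mathbb{Z}):\sum_nn^2|\psi(n)|^2<\infty\}$. $F(J)$, $F(J_\theta)$ are defined by the functional calculus. With $\mathbb{Z}_+=\{1,2,\dots\}$, $\mathbb{Z}_-=\{0,-1,\dots\}$ and $J_\pm$ the compression of $J$ to $\ell^2(\mathbb{Z}_\pm)$, for $\theta\in(0,\pi/2)$, $$J_\theta=\big(J_--\cot\theta\,\langle\delta_0,\cdot\rangle\delta_0\big)\oplus\big(J_+-\tan\theta\,\langle\delta_1,\cdot\rangle\delta_1\big).$$ Solutions at energy $E$ are functions $u:\mathbb{Z}\to\mathbb{C}$ with $a_{n-1}u(n-1)+a_nu(n+1)+b_nu(n)=Eu(n)$ for all $n$. For $L>1$ let $\|u\|_L=\big[\sum_{n=1}^{\lfloor L\rfloor}|u(n)|^2+(L-\lfloor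 L\rfloor)|u(\lfloor L\rfloor+1)|^2\big]^{1/2}$ on $\mathbb{Z}_+$, and analogously on $\mathbb{Z}_-$ (starting at $0$, going left). A nonzero solution $u$ is subordinate if for every linearly independent solution $v$ at the same energy $\|u\|_L/\|v\|_L\to0$ as $L\to\infty$, both on $\mathbb{Z}_+$ and on $\mathbb{Z}_-$. $S$ is the set of $E\in\mathbb{R}$ admitting a subordinate solution. For $\theta\in[0,\pi)$, $S_\theta$ is the set of $E\in S$ whose subordinate solution (unique up to scalars) satisfies $u(0)\cos\theta+u(1)\sin\theta=0$; thus $S=\bigcup_\theta S_\theta$. $\widetilde S\subseteq S$ is a fixed Borel set with $\mu_s(\mathbb{R}\setminus\widetilde S)=0$ such that for all $E\in\widetilde S$, $k,j\in\mathbb{Z}$, $\lim_{\epsilon\to0}\frac{\mu_{kj}((E-\epsilon,E+\epsilon))}{\mu((E-\epsilon,E+\epsilon))}=\lim_{\epsilon\to0}\frac{M_{kj}(E+i\epsilon)}{M(E+i\epsilon)}=u_E(k)u_E(j)$, where $u_E$ is the real-valued subordinate solution with $|u_E(0)|^2+|u_E(1)|^2=1$ (unique up to sign); such a set exists. For Borel $B\subseteq[0,\pi)$, $S_B=\bigcup_{\theta\in B}S_\theta\cap\widetilde S$ (a Borel set), and $Q(B)=P(S_B)$; $Q$ is a projection-valued measure.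
   Formalization: J_θ is taken with coefficients a_0 cot θ and a_0 tan θ (the stated cot θ, tan θ make the claim false when a_0 ≠ 1; they agree when a_0 = 1), and the strict inequality is claimed only when Q([α,β))ψ ≠ 0, with ≤ in general. *)

theory Defs
  imports "HOL-Analysis.Analysis"
begin

section \<open>The Hilbert space of square-summable functions on the integers\<close>

definition square_summable :: "(int \<Rightarrow> complex) \<Rightarrow> bool"
  where "square_summable f \<longleftrightarrow> (\<lambda>n. (cmod (f n))\<^sup>2) summable_on UNIV"

typedef ell2 = "{f. square_summable f}"
  morphisms coord Abs_ell2
  by (rule exI[of _ "\<lambda>_. 0"]) (simp add: square_summable_def)

setup_lifting type_definition_ell2

lemma coord_square_summable: "square_summable (coord x)"
  using coord[of x] by simp

lemma ell2_eqI: "(\<And>n. coord x n = coord y n) \<Longrightarrow> x = y"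
  by (metis coord_inject ext)

lemma square_summable_zero: "square_summable (\<lambda>_. 0)"
  by (simp add: square_summable_def)

lemma square_summable_scale:
  assumes "square_summable f"
  shows "square_summable (\<lambda>n. c * f n)"
  using summable_on_cmult_right[of "\<lambda>n. (cmod (f n))\<^sup>2" UNIV "(cmod c)\<^sup>2"] assms
  by (simp add: square_summable_def norm_mult power_mult_distrib)

lemma square_summable_mono:
  assumes "square_summable f" "\<And>n. cmod (g n) \<le> C * cmod (f n)"
  shows "square_summable g"
proof -
  have "(cmod (g n))\<^sup>2 \<le> C\<^sup>2 * (cmod (f n))\<^sup>2" for n
    using power_mono[OF assms(2)[of n], of 2] by (simp add: power_mult_distrib)
  moreover have "(\<lambda>n. C\<^sup>2 * (cmod (f n))\<^sup>2) summable_on UNIV"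
    using assms(1) unfolding square_summable_def by (rule summable_on_cmult_right)
  ultimately show ?thesis
    using summable_on_comparison_test[where A = UNIV and g = "\<lambda>n. (cmod (g n))\<^sup>2"]
    unfolding square_summable_def by simp
qed

lemma square_summable_add:
  assumes "square_summable f" "square_summable g"
  shows "square_summable (\<lambda>n. f n + g n)"
proof -
  have "(cmod (f n + g n))\<^sup>2 \<le> 2 * (cmod (f n))\<^sup>2 + 2 * (cmod (g n))\<^sup>2" for n
  proof -
    have "(cmod (f n + g n))\<^sup>2 \<le> (cmod (f n) + cmod (g n))\<^sup>2"
      by (intro power_mono norm_triangle_ineq) auto
    also have "\<dots> \<le> 2 * (cmod (f n))\<^sup>2 + 2 * (cmod (g n))\<^sup>2"
      using sum_squares_bound[of "cmod (f n)" "cmod (g n)"] by (simp add: power2_sum)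
    finally show ?thesis .
  qed
  moreover have "(\<lambda>n. 2 * (cmod (f n))\<^sup>2 + 2 * (cmod (g n))\<^sup>2) summable_on UNIV"
    using assms unfolding square_summable_def
    by (intro summable_on_add summable_on_cmult_right)
  ultimately show ?thesis
    using summable_on_comparison_test[where A = UNIV and g = "\<lambda>n. (cmod (f n + g n))\<^sup>2"]
    unfolding square_summable_def by simp
qed

lemma square_summable_shift:
  assumes "square_summable f"
  shows "square_summable (\<lambda>n. f (n + k))"
proof -
  have "bij (\<lambda>n::int. n + k)"
    by (rule bij_betwI[where g = "\<lambda>n. n - k"]) auto
  from summable_on_reindex_bij_betw[OF this, of "\<lambda>n. (cmod (f n))\<^sup>2"] assms
  show ?thesis by (simp add: square_summable_def)
qed

lemma square_summable_product:
  assumes "square_summable f" "square_summable g"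
  shows "(\<lambda>n. f n * cnj (g n)) summable_on UNIV"
proof -
  have le: "norm (f n * cnj (g n)) \<le> (cmod (f n))\<^sup>2 + (cmod (g n))\<^sup>2" for n
  proof -
    have "2 * (cmod (f n) * cmod (g n)) \<le> (cmod (f n))\<^sup>2 + (cmod (g n))\<^sup>2"
      using sum_squares_bound[of "cmod (f n)" "cmod (g n)"] by simp
    moreover have "0 \<le> cmod (f n) * cmod (g n)" by simp
    ultimately have "cmod (f n) * cmod (g n) \<le> (cmod (f n))\<^sup>2 + (cmod (g n))\<^sup>2"
      by linarith
    then show ?thesis by (simp add: norm_mult)
  qed
  have "(\<lambda>n. (cmod (f n))\<^sup>2 + (cmod (g n))\<^sup>2) summable_on UNIV"
    using assms unfolding square_summable_def by (rule summable_on_add)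
  then have "(\<lambda>n. norm (f n * cnj (g n))) summable_on UNIV"
    by (rule Infinite_Sum.abs_summable_on_comparison_test') (rule le)
  then show ?thesis by (rule abs_summable_summable)
qed

lift_definition scaleC :: "complex \<Rightarrow> ell2 \<Rightarrow> ell2" (infixr \<open>*\<^sub>C\<close> 75)
  is "\<lambda>c f n. c * f n"
  by (rule square_summable_scale)

definition cinner :: "ell2 \<Rightarrow> ell2 \<Rightarrow> complex"
  where "cinner x y = (\<Sum>\<^sub>\<infinity>n. coord x n * cnj (coord y n))"

instantiation ell2 :: real_vector
begin

lift_definition zero_ell2 :: ell2 is "\<lambda>_. 0"
  by (rule square_summable_zero)

lift_definition plus_ell2 :: "ell2 \<Rightarrow> ell2 \<Rightarrow> ell2" is "\<lambda>f g n. f n + g n"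
  by (rule square_summable_add)

lift_definition uminus_ell2 :: "ell2 \<Rightarrow> ell2" is "\<lambda>f n. - f n"
  by (simp add: square_summable_def)

definition minus_ell2 :: "ell2 \<Rightarrow> ell2 \<Rightarrow> ell2" where "minus_ell2 x y = x + (- y)"

definition scaleR_ell2 :: "real \<Rightarrow> ell2 \<Rightarrow> ell2" where "scaleR_ell2 r x = complex_of_real r *\<^sub>C x"

instance
proof
  fix x y z :: ell2 and r s :: real
  show "x + y + z = x + (y + z)" "x + y = y + x" "0 + x = x" "- x + x = 0"
    by (transfer; simp add: algebra_simps)+
  show "x - y = x + - y" by (simp add: minus_ell2_def)
  show "r *\<^sub>R (x + y) = r *\<^sub>R x + r *\<^sub>R y" "(r + s) *\<^sub>R x = r *\<^sub>R x + s *\<^sub>R x"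
       "r *\<^sub>R s *\<^sub>R x = (r * s) *\<^sub>R x" "1 *\<^sub>R x = x"
    unfolding scaleR_ell2_def by (transfer; simp add: algebra_simps)+
qed

end

instantiation ell2 :: real_inner
begin

definition inner_ell2 :: "ell2 \<Rightarrow> ell2 \<Rightarrow> real" where "inner_ell2 x y = Re (cinner x y)"

definition norm_ell2 :: "ell2 \<Rightarrow> real" where "norm_ell2 x = sqrt (inner x x)"

definition dist_ell2 :: "ell2 \<Rightarrow> ell2 \<Rightarrow> real" where "dist_ell2 x y = norm (x - y)"

definition sgn_ell2 :: "ell2 \<Rightarrow> ell2" where "sgn_ell2 x = inverse (norm x) *\<^sub>R x"

definition uniformity_ell2 :: "(ell2 \<times> ell2) filter"
  where "uniformity_ell2 = (INF e\<in>{0<..}. principal {(x, y). dist x y < e})"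

definition open_ell2 :: "ell2 set \<Rightarrow> bool"
  where "open_ell2 U \<longleftrightarrow> (\<forall>x\<in>U. \<forall>\<^sub>F (x', y) in uniformity. x' = x \<longrightarrow> y \<in> U)"

instance
proof
  fix x y z :: ell2 and r s :: real
  have summ: "(\<lambda>n. coord u n * cnj (coord v n)) summable_on UNIV" for u v
    by (intro square_summable_product coord_square_summable)
  show "sgn x = x /\<^sub>R norm x" by (simp add: sgn_ell2_def)
  show "dist x y = norm (x - y)" by (simp add: dist_ell2_def)
  show "uniformity = (INF e\<in>{0<..}. principal {(x, y :: ell2). dist x y < e})"
    by (rule uniformity_ell2_def)
  show "open U \<longleftrightarrow> (\<forall>x\<in>U. \<forall>\<^sub>F (x', y) in uniformity. x' = x \<longrightarrow> y \<in> U)" for U :: "ell2 set"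
    by (rule open_ell2_def)
  have "cinner x y = cnj (cinner y x)"
    unfolding cinner_def infsum_cnj[symmetric] by (simp add: mult.commute)
  then show "inner x y = inner y x" by (simp add: inner_ell2_def)
  show "inner (x + y) z = inner x z + inner y z"
    unfolding inner_ell2_def cinner_def
    using infsum_add[OF summ[of x z] summ[of y z]]
    by (simp add: plus_ell2.rep_eq algebra_simps)
  show "inner (r *\<^sub>R x) y = r * inner x y"
    unfolding inner_ell2_def cinner_def scaleR_ell2_def
    by (simp add: scaleC.rep_eq mult.assoc infsum_cmult_right')
  have sq: "inner x x = (\<Sum>\<^sub>\<infinity>n. (cmod (coord x n))\<^sup>2)"
    unfolding inner_ell2_def cinner_def
    using infsum_Re[OF summ[of x x]] unfolding complex_norm_square[symmetric] by simp
  show "0 \<le> inner x x"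
    unfolding sq by (rule infsum_nonneg) simp
  show "inner x x = 0 \<longleftrightarrow> x = 0"
  proof
    assume "inner x x = 0"
    then have "(cmod (coord x n))\<^sup>2 = 0" for n
      using coord_square_summable[of x] unfolding sq square_summable_def
      by (intro nonneg_infsum_le_0D[where A = UNIV and f = "\<lambda>n. (cmod (coord x n))\<^sup>2"]) auto
    then show "x = 0" by (intro ell2_eqI) (simp add: zero_ell2.rep_eq)
  next
    assume "x = 0"
    then show "inner x x = 0" unfolding sq by (simp add: zero_ell2.rep_eq)
  qed
  show "norm x = sqrt (inner x x)" by (rule norm_ell2_def)
qed

end

lift_definition delta :: "int \<Rightarrow> ell2" is "\<lambda>k n. if n = k then 1 else 0"
proof -
  fix k :: int
  have "(\<lambda>n. (cmod (if n = k then 1 else 0))\<^sup>2) summable_on UNIV \<longleftrightarrow>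
        (\<lambda>n. (cmod (if n = k then 1 else 0))\<^sup>2) summable_on {k}"
    by (rule summable_on_cong_neutral) auto
  then show "square_summable (\<lambda>n. if n = k then 1 else 0)"
    by (simp add: square_summable_def)
qed

text \<open>Orthogonal projection of \<open>\<ell>\<^sup>2(\<int>)\<close> onto \<open>\<ell>\<^sup>2(A)\<close>.\<close>

lift_definition restrict_to :: "int set \<Rightarrow> ell2 \<Rightarrow> ell2" is "\<lambda>A f n. if n \<in> A then f n else 0"
  by (erule square_summable_mono[where C = 1]) simp

definition H_plus :: "ell2 set"
  where "H_plus = {\<psi>. (\<lambda>n. (real_of_int n)\<^sup>2 * (cmod (coord \<psi> n))\<^sup>2) summable_on UNIV}"


section \<open>Spectral measures and functional calculus\<close>

definition orthogonal_projection :: "(ell2 \<Rightarrow> ell2) \<Rightarrow> bool"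
  where "orthogonal_projection A \<longleftrightarrow>
    (\<forall>x y. A (x + y) = A x + A y) \<and> (\<forall>c x. A (c *\<^sub>C x) = c *\<^sub>C A x) \<and>
    (\<forall>x. A (A x) = A x) \<and> (\<forall>x y. cinner (A x) y = cinner x (A y))"

definition projection_valued_measure :: "(real set \<Rightarrow> ell2 \<Rightarrow> ell2) \<Rightarrow> bool"
  where "projection_valued_measure P \<longleftrightarrow>
    (\<forall>B\<in>sets borel. orthogonal_projection (P B)) \<and>
    P UNIV = id \<and>
    (\<forall>(A :: nat \<Rightarrow> real set) \<psi>. range A \<subseteq> sets borel \<and> disjoint_family A \<longrightarrow>
       (\<lambda>n. P (A n) \<psi>) sums P (\<Union>n. A n) \<psi>)"

definition spec_meas :: "(real set \<Rightarrow> ell2 \<Rightarrow> ell2) \<Rightarrow> ell2 \<Rightarrow> real measure"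
  where "spec_meas P \<psi> =
    measure_of UNIV (sets borel) (\<lambda>B. ennreal (Re (cinner (P B \<psi>) \<psi>)))"

text \<open>The integral of \<open>f\<close> against the complex measure \<open>B \<mapsto> \<langle>P(B)\<phi>, \<psi>\<rangle>\<close>. By polarization this
  measure equals \<open>1/4 \<Sum>k<4. \<i>^k \<mu>\<close>, with \<open>\<mu>\<close> the positive measure of \<open>\<phi> + \<i>^k \<psi>\<close>;
  the inner product is linear in its first argument.\<close>

definition spec_integral ::
    "(real set \<Rightarrow> ell2 \<Rightarrow> ell2) \<Rightarrow> (real \<Rightarrow> complex) \<Rightarrow> ell2 \<Rightarrow> ell2 \<Rightarrow> complex"
  where "spec_integral P f \<phi> \<psi> =
    (1 / 4) * (\<Sum>k<4. \<i> ^ k * (\<integral>x. f x \<partial>spec_meas P (\<phi> + \<i> ^ k *\<^sub>C \<psi>)))"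

text \<open>\<open>P\<close> is the spectral measure of the bounded self-adjoint operator \<open>T\<close>: \<open>T = \<integral> E dP(E)\<close>.
  By the spectral theorem there is exactly one such \<open>P\<close> on the Borel sets, and it has compact
  support because \<open>T\<close> is bounded.\<close>

definition is_spectral_measure :: "(ell2 \<Rightarrow> ell2) \<Rightarrow> (real set \<Rightarrow> ell2 \<Rightarrow> ell2) \<Rightarrow> bool"
  where "is_spectral_measure T P \<longleftrightarrow>
    projection_valued_measure P \<and> (\<exists>K. compact K \<and> P K = id) \<and>
    (\<forall>\<phi> \<psi>. cinner (T \<phi>) \<psi> = spec_integral P complex_of_real \<phi> \<psi>)"

text \<open>\<open>F(T) = \<integral> F dP\<close> for the spectral measure \<open>P\<close> of \<open>T\<close>, in the weak sense.\<close>

definition functional_calculus ::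
    "(real set \<Rightarrow> ell2 \<Rightarrow> ell2) \<Rightarrow> (real \<Rightarrow> complex) \<Rightarrow> ell2 \<Rightarrow> ell2"
  where "functional_calculus P F \<phi> = (THE \<eta>. \<forall>\<psi>. cinner \<eta> \<psi> = spec_integral P F \<phi> \<psi>)"

definition mu_entry :: "(real set \<Rightarrow> ell2 \<Rightarrow> ell2) \<Rightarrow> int \<Rightarrow> int \<Rightarrow> real set \<Rightarrow> complex"
  where "mu_entry P k j B = cinner (P B (delta k)) (delta j)"

definition mu_trace :: "(real set \<Rightarrow> ell2 \<Rightarrow> ell2) \<Rightarrow> real measure"
  where "mu_trace P = measure_of UNIV (sets borel)
    (\<lambda>B. emeasure (spec_meas P (delta 0)) B + emeasure (spec_meas P (delta 1)) B)"

definition M_entry :: "(real set \<Rightarrow> ell2 \<Rightarrow> ell2) \<Rightarrow> int \<Rightarrow> int \<Rightarrow> complex \<Rightarrow> complex"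
  where "M_entry P k j z = spec_integral P (\<lambda>E. 1 / (complex_of_real E - z)) (delta k) (delta j)"

definition M_trace :: "(real set \<Rightarrow> ell2 \<Rightarrow> ell2) \<Rightarrow> complex \<Rightarrow> complex"
  where "M_trace P z = (\<integral>E. 1 / (complex_of_real E - z) \<partial>mu_trace P)"

definition lebesgue_decomposition :: "real measure \<Rightarrow> real measure \<Rightarrow> real measure \<Rightarrow> bool"
  where "lebesgue_decomposition \<mu> \<mu>_ac \<mu>_s \<longleftrightarrow>
    sets \<mu>_ac = sets borel \<and> sets \<mu>_s = sets borel \<and>
    (\<forall>B\<in>sets borel. emeasure \<mu> B = emeasure \<mu>_ac B + emeasure \<mu>_s B) \<and>
    absolutely_continuous lborel \<mu>_ac \<and>
    (\<exists>N\<in>null_sets lborel. emeasure \<mu>_s (UNIV - N) = 0)"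


section \<open>Jacobi operators and their subordinate solutions\<close>

definition jacobi_expr :: "(int \<Rightarrow> real) \<Rightarrow> (int \<Rightarrow> real) \<Rightarrow> (int \<Rightarrow> complex) \<Rightarrow> int \<Rightarrow> complex"
  where "jacobi_expr a b u n =
    of_real (a (n - 1)) * u (n - 1) + of_real (a n) * u (n + 1) + of_real (b n) * u n"

lemma square_summable_bounded_mult:
  assumes "bounded (range c)" "square_summable f"
  shows "square_summable (\<lambda>n. complex_of_real (c n) * f n)"
proof -
  obtain C where "\<And>n. \<bar>c n\<bar> \<le> C"
    using assms(1) unfolding bounded_iff by auto
  then show ?thesis
    by (intro square_summable_mono[OF assms(2), of _ C]) (simp add: norm_mult mult_right_mono)
qed

lemma square_summable_jacobi_expr:
  assumes a: "bounded (range a)" and b: "bounded (range b)" and f: "square_summable f"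
  shows "square_summable (jacobi_expr a b f)"
proof -
  have "bounded (range (\<lambda>n. a (n - 1)))"
    by (rule bounded_subset[OF a]) auto
  then show ?thesis
    unfolding jacobi_expr_def
    using square_summable_shift[OF f, of "-1"] square_summable_shift[OF f, of 1]
    by (intro square_summable_add square_summable_bounded_mult a b f) simp_all
qed

definition jacobi_op :: "(int \<Rightarrow> real) \<Rightarrow> (int \<Rightarrow> real) \<Rightarrow> ell2 \<Rightarrow> ell2"
  where "jacobi_op a b \<psi> = Abs_ell2 (jacobi_expr a b (coord \<psi>))"

lemma coord_jacobi_op:
  assumes "bounded (range a)" "bounded (range b)"
  shows "coord (jacobi_op a b \<psi>) = jacobi_expr a b (coord \<psi>)"
  unfolding jacobi_op_def
  by (rule Abs_ell2_inverse)
     (simp add: square_summable_jacobi_expr[OF assms coord_square_summable])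

text \<open>\<open>J\<^sub>\<theta>\<close> on \<open>\<ell>\<^sup>2(\<int>) = \<ell>\<^sup>2({..0}) \<oplus> \<ell>\<^sup>2({1..})\<close>: the two half-line compressions with the boundary
  condition \<open>u(0) cos \<theta> + u(1) sin \<theta> = 0\<close>. Substituting \<open>u(1) = - cot \<theta> u(0)\<close> into the expression at
  site 0, and \<open>u(0) = - tan \<theta> u(1)\<close> into that at site 1, turns the coupling terms \<open>a\<^sub>0 u(1)\<close> and
  \<open>a\<^sub>0 u(0)\<close> into \<open>- a\<^sub>0 cot \<theta> u(0)\<close> and \<open>- a\<^sub>0 tan \<theta> u(1)\<close>. Hence the factor \<open>a\<^sub>0\<close>, which is
  invisible in the normalization \<open>a\<^sub>0 = 1\<close>.\<close>

definition jacobi_theta :: "(int \<Rightarrow> real) \<Rightarrow> (int \<Rightarrow> real) \<Rightarrow> real \<Rightarrow> ell2 \<Rightarrow> ell2"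
  where "jacobi_theta a b \<theta> \<psi> =
    (restrict_to {..0} (jacobi_op a b (restrict_to {..0} \<psi>))
       - (of_real (a 0 * cot \<theta>) * cinner \<psi> (delta 0)) *\<^sub>C delta 0)
    + (restrict_to {1..} (jacobi_op a b (restrict_to {1..} \<psi>))
       - (of_real (a 0 * tan \<theta>) * cinner \<psi> (delta 1)) *\<^sub>C delta 1)"

definition is_solution ::
    "(int \<Rightarrow> real) \<Rightarrow> (int \<Rightarrow> real) \<Rightarrow> real \<Rightarrow> (int \<Rightarrow> complex) \<Rightarrow> bool"
  where "is_solution a b E u \<longleftrightarrow> (\<forall>n. jacobi_expr a b u n = of_real E * u n)"

definition lin_indep_fun :: "(int \<Rightarrow> complex) \<Rightarrow> (int \<Rightarrow> complex) \<Rightarrow> bool"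
  where "lin_indep_fun u v \<longleftrightarrow>
    (\<forall>c d. (\<forall>n. c * u n + d * v n = 0) \<longrightarrow> c = 0 \<and> d = 0)"

definition right_norm :: "real \<Rightarrow> (int \<Rightarrow> complex) \<Rightarrow> real"
  where "right_norm L u = sqrt ((\<Sum>n = 1..\<lfloor>L\<rfloor>. (cmod (u n))\<^sup>2)
    + (L - of_int \<lfloor>L\<rfloor>) * (cmod (u (\<lfloor>L\<rfloor> + 1)))\<^sup>2)"

text \<open>The left half-line is \<open>0, -1, -2, \<dots>\<close>; the reflection \<open>n \<mapsto> 1 - n\<close> maps \<open>1, 2, \<dots>\<close> onto it.\<close>

definition left_norm :: "real \<Rightarrow> (int \<Rightarrow> complex) \<Rightarrow> real"
  where "left_norm L u = right_norm L (\<lambda>n. u (1 - n))"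

definition subordinate ::
    "(int \<Rightarrow> real) \<Rightarrow> (int \<Rightarrow> real) \<Rightarrow> real \<Rightarrow> (int \<Rightarrow> complex) \<Rightarrow> bool"
  where "subordinate a b E u \<longleftrightarrow>
    is_solution a b E u \<and> (\<exists>n. u n \<noteq> 0) \<and>
    (\<forall>v. is_solution a b E v \<and> lin_indep_fun u v \<longrightarrow>
       ((\<lambda>L. right_norm L u / right_norm L v) \<longlongrightarrow> 0) at_top \<and>
       ((\<lambda>L. left_norm L u / left_norm L v) \<longlongrightarrow> 0) at_top)"

definition sub_set :: "(int \<Rightarrow> real) \<Rightarrow> (int \<Rightarrow> real) \<Rightarrow> real set"
  where "sub_set a b = {E. \<exists>u. subordinate a b E u}"

definition sub_set_theta :: "(int \<Rightarrow> real) \<Rightarrow> (int \<Rightarrow> real) \<Rightarrow> real \<Rightarrow> real set"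
  where "sub_set_theta a b \<theta> =
    {E. \<exists>u. subordinate a b E u \<and> u 0 * of_real (cos \<theta>) + u 1 * of_real (sin \<theta>) = 0}"

text \<open>The defining properties of the set \<open>S\<close>-tilde (here \<open>S\<close>); the real function \<open>u\<close> is \<open>u\<^sub>E\<close>, which is
  determined up to sign.\<close>

definition admissible_support ::
    "(int \<Rightarrow> real) \<Rightarrow> (int \<Rightarrow> real) \<Rightarrow> (real set \<Rightarrow> ell2 \<Rightarrow> ell2) \<Rightarrow> real set \<Rightarrow> bool"
  where "admissible_support a b P S \<longleftrightarrow>
    S \<in> sets borel \<and> S \<subseteq> sub_set a b \<and>
    (\<exists>\<mu>_ac \<mu>_s. lebesgue_decomposition (mu_trace P) \<mu>_ac \<mu>_s \<and> emeasure \<mu>_s (UNIV - S) = 0) \<and>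
    (\<forall>E\<in>S. \<exists>u :: int \<Rightarrow> real.
       subordinate a b E (\<lambda>n. of_real (u n)) \<and> \<bar>u 0\<bar>\<^sup>2 + \<bar>u 1\<bar>\<^sup>2 = 1 \<and>
       (\<forall>k j.
          ((\<lambda>\<epsilon>. mu_entry P k j {E - \<epsilon><..<E + \<epsilon>} /
                 of_real (measure (mu_trace P) {E - \<epsilon><..<E + \<epsilon>}))
             \<longlongrightarrow> of_real (u k * u j)) (at_right 0) \<and>
          ((\<lambda>\<epsilon>. M_entry P k j (Complex E \<epsilon>) / M_trace P (Complex E \<epsilon>))
             \<longlongrightarrow> of_real (u k * u j)) (at_right 0)))"

definition S_part :: "(int \<Rightarrow> real) \<Rightarrow> (int \<Rightarrow> real) \<Rightarrow> real set \<Rightarrow> real set \<Rightarrow> real set"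
  where "S_part a b S B = (\<Union>\<theta>\<in>B. sub_set_theta a b \<theta>) \<inter> S"

definition Q_meas ::
    "(int \<Rightarrow> real) \<Rightarrow> (int \<Rightarrow> real) \<Rightarrow> (real set \<Rightarrow> ell2 \<Rightarrow> ell2) \<Rightarrow> real set \<Rightarrow>
     real set \<Rightarrow> ell2 \<Rightarrow> ell2"
  where "Q_meas a b P S B = P (S_part a b S B)"


section \<open>The class of test functions\<close>

definition monomial_funs :: "(real \<Rightarrow> complex) set"
  where "monomial_funs = {\<lambda>x. of_real x ^ n | n :: nat. True}"

definition exponential_funs :: "(real \<Rightarrow> complex) set"
  where "exponential_funs = {\<lambda>x. exp (\<i> * of_real t * of_real x) | t :: real. True}"

definition resolvent_funs :: "(real \<Rightarrow> complex) set"
  where "resolvent_funs = {\<lambda>x. inverse (of_real x - z) | z :: complex. Im z > 0}"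

text \<open>The complex linear span, with the pointwise vector space structure.\<close>

definition test_funs :: "(real \<Rightarrow> complex) set"
  where "test_funs =
    {\<lambda>x. \<Sum>g\<in>G. c g * g x | G c.
       finite G \<and> G \<subseteq> monomial_funs \<union> exponential_funs \<union> resolvent_funs}"

end

theory Submission
  imports Defs
begin

text \<open>
  Let \<open>A\<close> be the set of energies in \<open>S\<close> whose subordinate solution satisfies a boundary condition with angle in
  \<open>[\<alpha>, \<beta>)\<close>, so that \<open>Q([\<alpha>, \<beta>)) = P(A)\<close>, and fix \<open>\<theta>\<close> in this interval. The operator \<open>J\<^sub>\<theta> - J\<close> has rank
  one: it maps \<open>\<eta>\<close> to the number \<open>\<eta>(0) cos \<theta> + \<eta>(1) sin \<theta> = \<langle>\<eta>, \<chi>\<^sub>\<theta>\<rangle>\<close>, with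
  \<open>\<chi>\<^sub>\<theta> = cos \<theta> \<delta>\<^sub>0 + sin \<theta> \<delta>\<^sub>1\<close>, times a vector that stays bounded while \<open>\<theta>\<close> stays away from \<open>0\<close> and
  \<open>\<pi>/2\<close> (lemma \<open>jacobi_theta_difference\<close>). If \<open>\<eta>\<close> lies in the range of \<open>P(A)\<close>, this number is
  \<open>\<langle>\<eta>, P(A) \<chi>\<^sub>\<theta>\<rangle>\<close>, so it suffices that \<open>\<parallel>P(A) \<chi>\<^sub>\<theta>\<parallel>\<^sup>2\<close>, the spectral measure of \<open>A\<close> for \<open>\<chi>\<^sub>\<theta>\<close>, is
  \<open>O((\<beta> - \<alpha>)\<^sup>2)\<close>.

  The hypothesis on the set \<open>S\<close> gives the density of this measure with respect to \<open>\<mu>\<close> at each energy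
  \<open>E\<close> of \<open>A\<close> as \<open>(u\<^sub>E(0) cos \<theta> + u\<^sub>E(1) sin \<theta>)\<^sup>2 = sin\<^sup>2 (\<theta>' - \<theta>) < (\<beta> - \<alpha>)\<^sup>2\<close>, where \<open>\<theta>'\<close> is the
  angle of \<open>u\<^sub>E\<close>. Passing from the pointwise density to the measure of \<open>A\<close> needs only an upper bound with
  some constant, for which an elementary covering argument by intervals is enough
  (\<open>measure_le_by_interval_differentiation\<close>). The outcome is \<open>norm_P_boundary_vector_le\<close>. Measurability of
  \<open>A\<close> follows from the same limits and the uniqueness of the subordinate solution (\<open>S_part_borel\<close>).

  Hence \<open>J\<^sub>\<theta> - J\<close> is of size \<open>O(\<beta> - \<alpha>)\<close> on the range of \<open>P(A)\<close>, and this range is invariant under all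
  functions of \<open>J\<close>. Telescoping handles the powers, the exponential series reduces the exponentials to
  them, and the second resolvent identity handles the resolvents; linear combinations follow
  (\<open>test_fun_difference\<close>). The rules of the functional calculus used here, in particular multiplicativity
  (\<open>calc_mult\<close>), come from the corresponding rules for the projections \<open>P(B)\<close>: two linear functionals of a
  bounded Borel function that are continuous in the supremum norm agree as soon as they agree on indicators
  (\<open>bounded_functional_eqI\<close>).
\<close>


section \<open>The complex inner product and the Riesz representation theorem\<close>

lemma cinner_summable: "(\<lambda>n. coord x n * cnj (coord y n)) summable_on UNIV"
  by (intro square_summable_product coord_square_summable)

lemma cinner_add_left: "cinner (x + y) z = cinner x z + cinner y z"
  unfolding cinner_def using infsum_add[OF cinner_summable[of x z] cinner_summable[of y z]]
  by (simp add: plus_ell2.rep_eq algebra_simps)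

lemma cinner_scale_left: "cinner (c *\<^sub>C x) y = c * cinner x y"
  unfolding cinner_def by (simp add: scaleC.rep_eq mult.assoc infsum_cmult_right')

lemma cinner_commute: "cinner y x = cnj (cinner x y)"
  unfolding cinner_def infsum_cnj[symmetric] by (simp add: mult.commute)

lemma cinner_add_right: "cinner x (y + z) = cinner x y + cinner x z"
  by (subst (1 2 3) cinner_commute) (simp add: cinner_add_left)

lemma cinner_scale_right: "cinner x (c *\<^sub>C y) = cnj c * cinner x y"
  by (subst (1 2) cinner_commute) (simp add: cinner_scale_left)

lemma uminus_scaleC: "- x = (-1) *\<^sub>C x"
  by (rule ell2_eqI) (simp add: scaleC.rep_eq uminus_ell2.rep_eq)

lemma cinner_minus_left: "cinner (- x) y = - cinner x y"
  by (simp add: uminus_scaleC cinner_scale_left)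

lemma cinner_diff_left: "cinner (x - y) z = cinner x z - cinner y z"
  by (simp only: diff_conv_add_uminus cinner_add_left cinner_minus_left)

lemma cinner_zero_left [simp]: "cinner 0 y = 0"
  by (simp add: cinner_def zero_ell2.rep_eq)

lemma cinner_zero_right [simp]: "cinner y 0 = 0"
  by (simp add: cinner_def zero_ell2.rep_eq)

lemma cinner_self: "cinner x x = of_real ((norm x)\<^sup>2)"
proof (rule complex_eqI)
  show "Re (cinner x x) = Re (of_real ((norm x)\<^sup>2))"
    by (simp add: power2_norm_eq_inner inner_ell2_def)
  have "cinner x x = cnj (cinner x x)" by (rule cinner_commute)
  then show "Im (cinner x x) = Im (of_real ((norm x)\<^sup>2))"
    by (metis Im_complex_of_real cnj.simps(2) equal_neg_zero)
qed

lemma scaleC_simps [simp]: "0 *\<^sub>C x = 0" "1 *\<^sub>C x = x" "c *\<^sub>C (d *\<^sub>C x) = (c * d) *\<^sub>C x" "c *\<^sub>C 0 = 0"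
  by (rule ell2_eqI, simp add: scaleC.rep_eq zero_ell2.rep_eq)+

lemma scaleC_add_right: "c *\<^sub>C (x + y) = c *\<^sub>C x + c *\<^sub>C y"
  by (rule ell2_eqI) (simp add: scaleC.rep_eq plus_ell2.rep_eq algebra_simps)

lemma scaleC_minus_right: "c *\<^sub>C (- x) = - (c *\<^sub>C x)"
  by (rule ell2_eqI) (simp add: scaleC.rep_eq uminus_ell2.rep_eq)

lemma scaleC_diff_right: "c *\<^sub>C (x - y) = c *\<^sub>C x - c *\<^sub>C y"
  by (simp only: diff_conv_add_uminus scaleC_add_right scaleC_minus_right)

lemma cnj_mult_self: "c * cnj c = (of_real (cmod c))\<^sup>2" "cnj c * c = (of_real (cmod c))\<^sup>2"
  using complex_norm_square[of c] by (simp_all add: mult.commute)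

lemma norm_scaleC: "norm (c *\<^sub>C x) = cmod c * norm x"
proof -
  have "complex_of_real ((norm (c *\<^sub>C x))\<^sup>2) = (c * cnj c) * cinner x x"
    unfolding cinner_self[symmetric] cinner_scale_left cinner_scale_right by (simp only: mult_ac)
  also have "\<dots> = of_real ((cmod c * norm x)\<^sup>2)"
    by (simp only: cinner_self cnj_mult_self power_mult_distrib of_real_mult of_real_power)
  finally have "complex_of_real ((norm (c *\<^sub>C x))\<^sup>2) = of_real ((cmod c * norm x)\<^sup>2)" .
  then have "(norm (c *\<^sub>C x))\<^sup>2 = (cmod c * norm x)\<^sup>2"
    by (simp only: of_real_eq_iff)
  then show ?thesis by (simp add: power2_eq_iff_nonneg)
qed

text \<open>The real inner product is the real part of \<open>cinner\<close>, so its Cauchy--Schwarz inequality applies once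
  \<open>x\<close> has been rotated by a phase that makes \<open>cinner x y\<close> nonnegative.\<close>

lemma cinner_cauchy_schwarz: "cmod (cinner x y) \<le> norm x * norm y"
proof (cases "cinner x y = 0")
  case False
  define c where "c = cnj (sgn (cinner x y))"
  have c: "cmod c = 1" using False by (simp add: c_def norm_sgn)
  have "c * cinner x y = cnj (cinner x y) * cinner x y / of_real (cmod (cinner x y))"
    by (simp add: c_def sgn_eq)
  also have "\<dots> = of_real (cmod (cinner x y))"
    unfolding cnj_mult_self using False by (simp add: power2_eq_square)
  finally have "c * cinner x y = of_real (cmod (cinner x y))" .
  then have "cmod (cinner x y) = inner (c *\<^sub>C x) y"
    by (simp add: inner_ell2_def cinner_scale_left)
  also have "\<dots> \<le> norm (c *\<^sub>C x) * norm y" by (rule norm_cauchy_schwarz)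
  finally show ?thesis by (simp add: norm_scaleC c)
qed simp

lemma cinner_ext: "(\<And>z. cinner x z = cinner y z) \<Longrightarrow> x = y"
proof -
  assume "\<And>z. cinner x z = cinner y z"
  then have "cinner (x - y) (x - y) = 0" by (simp only: cinner_diff_left) simp
  then show ?thesis by (simp add: cinner_self)
qed

lemma coord_delta: "coord (delta k) n = (if n = k then 1 else 0)"
  by (simp add: delta.rep_eq)

lemma cinner_delta: "cinner x (delta k) = coord x k"
proof -
  have "cinner x (delta k) = (\<Sum>\<^sub>\<infinity>n\<in>{k}. coord x n * cnj (coord (delta k) n))"
    unfolding cinner_def by (rule infsum_cong_neutral) (auto simp: coord_delta)
  then show ?thesis by (simp add: coord_delta)
qed

lemma norm_delta [simp]: "norm (delta k) = 1"
proof -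
  have "complex_of_real ((norm (delta k))\<^sup>2) = of_real 1"
    unfolding cinner_self[symmetric] by (simp add: cinner_delta coord_delta)
  then have "(norm (delta k))\<^sup>2 = 1" by (simp only: of_real_eq_iff)
  then show ?thesis using norm_ge_zero[of "delta k"] by (auto simp: power2_eq_1_iff)
qed

lemma coord_sum: "coord (sum f N) n = (\<Sum>k\<in>N. coord (f k) n)"
  by (induction N rule: infinite_finite_induct) (auto simp: zero_ell2.rep_eq plus_ell2.rep_eq)

lemma coord_finite_section:
  assumes "finite N"
  shows "coord (\<Sum>n\<in>N. h n *\<^sub>C delta n) k = (if k \<in> N then h k else 0)"
proof -
  have "coord (\<Sum>n\<in>N. h n *\<^sub>C delta n) k = (\<Sum>n\<in>N. if k = n then h n else 0)"
    unfolding coord_sum by (rule sum.cong) (auto simp: scaleC.rep_eq coord_delta)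
  also have "\<dots> = (if k \<in> N then h k else 0)" using assms by (rule sum.delta')
  finally show ?thesis .
qed

lemma coord_diff: "coord (x - y) n = coord x n - coord y n"
  unfolding minus_ell2_def plus_ell2.rep_eq uminus_ell2.rep_eq by simp

lemma norm_square_has_sum: "((\<lambda>n. (cmod (coord x n))\<^sup>2) has_sum (norm x)\<^sup>2) UNIV"
proof -
  have "((\<lambda>n. coord x n * cnj (coord x n)) has_sum cinner x x) UNIV"
    unfolding cinner_def by (rule has_sum_infsum[OF cinner_summable])
  then have "((\<lambda>n. Re (coord x n * cnj (coord x n))) has_sum Re (cinner x x)) UNIV"
    by (rule has_sum_Re)
  moreover have "Re (coord x n * cnj (coord x n)) = (cmod (coord x n))\<^sup>2" for n
    unfolding cnj_mult_self of_real_power[symmetric] by (rule Re_complex_of_real)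
  moreover have "Re (cinner x x) = (norm x)\<^sup>2"
    unfolding cinner_self by (rule Re_complex_of_real)
  ultimately show ?thesis by (simp only:)
qed

text \<open>The representing vector has the coordinates \<open>L(\<delta>\<^sub>n)\<close>. Testing \<open>L\<close> on the finite sections of these
  coordinates bounds their square sums, and finite sections of \<open>\<psi>\<close> converge to \<open>\<psi>\<close>.\<close>

lemma riesz_representation:
  fixes L :: "ell2 \<Rightarrow> complex"
  assumes add: "\<And>x y. L (x + y) = L x + L y" and scale: "\<And>c x. L (c *\<^sub>C x) = cnj c * L x"
    and bound: "\<And>x. cmod (L x) \<le> C * norm x"
  shows "\<exists>\<eta>. \<forall>\<psi>. cinner \<eta> \<psi> = L \<psi>"
proof -
  have L0: "L 0 = 0" using scale[of 0 0] by simp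
  have L_sum: "L (sum f N) = (\<Sum>k\<in>N. L (f k))" for f :: "int \<Rightarrow> ell2" and N
    by (induction N rule: infinite_finite_induct) (auto simp: L0 add)
  have L_diff: "L (x - y) = L x - L y" for x y
    by (simp only: diff_conv_add_uminus add uminus_scaleC[of y] scale) simp
  define h where "h n = L (delta n)" for n
  have C: "C \<ge> 0" using order_trans[OF norm_ge_zero bound[of "delta 0"]] by simp
  have fin: "(\<Sum>n\<in>N. (cmod (h n))\<^sup>2) \<le> C\<^sup>2" if N: "finite N" for N
  proof -
    define v where "v = (\<Sum>n\<in>N. h n *\<^sub>C delta n)"
    define s where "s = (\<Sum>n\<in>N. (cmod (h n))\<^sup>2)"
    have s0: "s \<ge> 0" unfolding s_def by (rule sum_nonneg) auto
    have "L v = (\<Sum>n\<in>N. cnj (h n) * h n)"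
      unfolding v_def L_sum by (simp add: scale h_def)
    also have "\<dots> = of_real s"
      unfolding s_def by (simp add: cnj_mult_self)
    finally have Lv: "L v = of_real s" .
    have cv: "coord v n = (if n \<in> N then h n else 0)" for n
      unfolding v_def by (rule coord_finite_section[OF N])
    have "((\<lambda>n. (cmod (coord v n))\<^sup>2) has_sum s) UNIV"
    proof -
      have "((\<lambda>n. (cmod (h n))\<^sup>2) has_sum s) N"
        unfolding s_def using N by (rule has_sum_finite)
      also have "?this \<longleftrightarrow> ((\<lambda>n. (cmod (coord v n))\<^sup>2) has_sum s) UNIV"
        by (rule has_sum_cong_neutral) (auto simp: cv)
      finally show ?thesis .
    qed
    with norm_square_has_sum[of v] have "(norm v)\<^sup>2 = s"
      by (rule has_sum_unique)
    then have "norm v = sqrt s" using real_sqrt_unique[of "norm v" s] by simp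
    with bound[of v] Lv s0 have "s \<le> C * sqrt s" by simp
    then have le: "sqrt s * sqrt s \<le> C * sqrt s" using s0 by simp
    have "sqrt s \<le> C"
    proof (cases "s = 0")
      case False
      with s0 have "sqrt s > 0" by simp
      with le show ?thesis by (rule mult_right_le_imp_le)
    qed (simp add: C)
    then have "s \<le> C\<^sup>2" by (rule sqrt_le_D)
    then show ?thesis by (simp add: s_def)
  qed
  have "square_summable h"
    unfolding square_summable_def
    by (rule nonneg_bdd_above_summable_on) (auto intro!: bdd_aboveI2[where M = "C\<^sup>2"] fin)
  then have ch: "coord (Abs_ell2 h) = h" by (simp add: Abs_ell2_inverse)
  have "cinner (Abs_ell2 h) \<psi> = L \<psi>" for \<psi>
  proof -
    define \<psi>N where "\<psi>N N = (\<Sum>n\<in>N. coord \<psi> n *\<^sub>C delta n)" for N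
    have "((\<lambda>n. h n * cnj (coord \<psi> n)) has_sum cinner (Abs_ell2 h) \<psi>) UNIV"
      using has_sum_infsum[OF cinner_summable[of "Abs_ell2 h" \<psi>]] by (simp add: ch cinner_def)
    then have lim1: "((\<lambda>N. \<Sum>n\<in>N. h n * cnj (coord \<psi> n)) \<longlongrightarrow> cinner (Abs_ell2 h) \<psi>) (finite_subsets_at_top UNIV)"
      by (simp add: has_sum_def)
    have "((\<lambda>N. \<Sum>n\<in>N. (cmod (coord \<psi> n))\<^sup>2) \<longlongrightarrow> (norm \<psi>)\<^sup>2) (finite_subsets_at_top UNIV)"
      using norm_square_has_sum[of \<psi>] by (simp add: has_sum_def)
    then have lim2: "((\<lambda>N. C * sqrt ((norm \<psi>)\<^sup>2 - (\<Sum>n\<in>N. (cmod (coord \<psi> n))\<^sup>2))) \<longlongrightarrow> C * sqrt ((norm \<psi>)\<^sup>2 - (norm \<psi>)\<^sup>2))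
        (finite_subsets_at_top UNIV)"
      by (intro tendsto_intros)
    have tail: "norm (\<psi> - \<psi>N N) = sqrt ((norm \<psi>)\<^sup>2 - (\<Sum>n\<in>N. (cmod (coord \<psi> n))\<^sup>2))" if N: "finite N" for N
    proof -
      have c: "coord (\<psi> - \<psi>N N) n = (if n \<in> N then 0 else coord \<psi> n)" for n
        unfolding \<psi>N_def coord_diff coord_finite_section[OF N] by simp
      have "((\<lambda>n. (cmod (coord \<psi> n))\<^sup>2) has_sum ((norm \<psi>)\<^sup>2 - (\<Sum>n\<in>N. (cmod (coord \<psi> n))\<^sup>2))) (UNIV - N)"
        by (rule has_sum_Diff[OF norm_square_has_sum has_sum_finite[OF N]]) simp
      also have "?this \<longleftrightarrow> ((\<lambda>n. (cmod (coord (\<psi> - \<psi>N N) n))\<^sup>2) has_sum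
          ((norm \<psi>)\<^sup>2 - (\<Sum>n\<in>N. (cmod (coord \<psi> n))\<^sup>2))) UNIV"
        by (rule has_sum_cong_neutral) (auto simp: c)
      finally have "((\<lambda>n. (cmod (coord (\<psi> - \<psi>N N) n))\<^sup>2) has_sum
          ((norm \<psi>)\<^sup>2 - (\<Sum>n\<in>N. (cmod (coord \<psi> n))\<^sup>2))) UNIV" .
      with norm_square_has_sum[of "\<psi> - \<psi>N N"]
      have "(norm (\<psi> - \<psi>N N))\<^sup>2 = (norm \<psi>)\<^sup>2 - (\<Sum>n\<in>N. (cmod (coord \<psi> n))\<^sup>2)"
        by (rule has_sum_unique)
      then show ?thesis using real_sqrt_unique[of "norm (\<psi> - \<psi>N N)"] by simp
    qed
    have "((\<lambda>N. L \<psi> - (\<Sum>n\<in>N. h n * cnj (coord \<psi> n))) \<longlongrightarrow> 0) (finite_subsets_at_top UNIV)"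
    proof (rule Lim_null_comparison)
      show "\<forall>\<^sub>F N in finite_subsets_at_top UNIV. norm (L \<psi> - (\<Sum>n\<in>N. h n * cnj (coord \<psi> n)))
          \<le> C * sqrt ((norm \<psi>)\<^sup>2 - (\<Sum>n\<in>N. (cmod (coord \<psi> n))\<^sup>2))"
      proof (rule eventually_finite_subsets_at_top_weakI)
        fix N :: "int set" assume N: "finite N"
        have "L (\<psi>N N) = (\<Sum>n\<in>N. h n * cnj (coord \<psi> n))"
          by (simp add: \<psi>N_def L_sum scale h_def mult.commute)
        then show "norm (L \<psi> - (\<Sum>n\<in>N. h n * cnj (coord \<psi> n))) \<le> C * sqrt ((norm \<psi>)\<^sup>2 - (\<Sum>n\<in>N. (cmod (coord \<psi> n))\<^sup>2))"
          using bound[of "\<psi> - \<psi>N N"] by (simp add: tail[OF N] L_diff)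
      qed
      show "((\<lambda>N. C * sqrt ((norm \<psi>)\<^sup>2 - (\<Sum>n\<in>N. (cmod (coord \<psi> n))\<^sup>2))) \<longlongrightarrow> 0) (finite_subsets_at_top UNIV)"
        using lim2 by simp
    qed
    moreover have "((\<lambda>N. L \<psi> - (\<Sum>n\<in>N. h n * cnj (coord \<psi> n))) \<longlongrightarrow> L \<psi> - cinner (Abs_ell2 h) \<psi>) (finite_subsets_at_top UNIV)"
      by (intro tendsto_intros lim1)
    ultimately have "L \<psi> - cinner (Abs_ell2 h) \<psi> = 0"
      using tendsto_unique finite_subsets_at_top_neq_bot by blast
    then show ?thesis by simp
  qed
  then show ?thesis by blast
qed


section \<open>Functionals on bounded Borel functions\<close>

definition bdd_borel :: "(real \<Rightarrow> complex) \<Rightarrow> bool"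
  where "bdd_borel f \<longleftrightarrow> f \<in> borel_measurable borel \<and> (\<exists>C. \<forall>x. cmod (f x) \<le> C)"

lemma bdd_borelI: "f \<in> borel_measurable borel \<Longrightarrow> (\<And>x. cmod (f x) \<le> C) \<Longrightarrow> bdd_borel f"
  by (auto simp: bdd_borel_def)

lemma bdd_borelE:
  assumes "bdd_borel f"
  obtains C where "f \<in> borel_measurable borel" "C \<ge> 0" "\<And>x. cmod (f x) \<le> C"
  using assms norm_ge_zero order_trans unfolding bdd_borel_def by blast

lemma bdd_borel_add:
  assumes "bdd_borel f" "bdd_borel g"
  shows "bdd_borel (\<lambda>x. f x + g x)"
proof -
  obtain C where C: "f \<in> borel_measurable borel" "\<And>x. cmod (f x) \<le> C"
    using assms(1) by (rule bdd_borelE) blast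
  obtain D where D: "g \<in> borel_measurable borel" "\<And>x. cmod (g x) \<le> D"
    using assms(2) by (rule bdd_borelE) blast
  show ?thesis
    by (rule bdd_borelI[where C = "C + D"])
       (use C(1) D(1) in measurable, rule norm_triangle_le, rule add_mono, rule C, rule D)
qed

lemma bdd_borel_mult:
  assumes "bdd_borel f" "bdd_borel g"
  shows "bdd_borel (\<lambda>x. f x * g x)"
proof -
  obtain C where C: "f \<in> borel_measurable borel" "C \<ge> 0" "\<And>x. cmod (f x) \<le> C"
    using assms(1) by (rule bdd_borelE) blast
  obtain D where D: "g \<in> borel_measurable borel" "\<And>x. cmod (g x) \<le> D"
    using assms(2) by (rule bdd_borelE) blast
  show ?thesis
    by (rule bdd_borelI[where C = "C * D"])
       (use C(1) D(1) in measurable, simp add: norm_mult mult_mono C D)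
qed

lemma bdd_borel_const: "bdd_borel (\<lambda>_. c)"
  by (rule bdd_borelI[where C = "cmod c"]) auto

lemma bdd_borel_indicator: "B \<in> sets borel \<Longrightarrow> bdd_borel (indicator B)"
  by (rule bdd_borelI[where C = 1]) (auto simp: indicator_def)

lemma bdd_borel_sum: "(\<And>i. i \<in> I \<Longrightarrow> bdd_borel (f i)) \<Longrightarrow> bdd_borel (\<lambda>x. \<Sum>i\<in>I. f i x)"
  by (induction I rule: infinite_finite_induct) (simp_all add: bdd_borel_const bdd_borel_add)

text \<open>Linear functionals on the bounded Borel functions that are continuous for the supremum norm. The
  functions \<open>f\<close> for which a spectral identity is to be shown always enter both of its sides through such
  functionals, which reduces the identity to indicator functions.\<close>

definition bounded_functional :: "((real \<Rightarrow> complex) \<Rightarrow> complex) \<Rightarrow> bool"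
  where "bounded_functional L \<longleftrightarrow>
    (\<forall>f g. bdd_borel f \<longrightarrow> bdd_borel g \<longrightarrow> L (\<lambda>x. f x + g x) = L f + L g) \<and>
    (\<forall>c f. bdd_borel f \<longrightarrow> L (\<lambda>x. c * f x) = c * L f) \<and>
    (\<exists>M. \<forall>f C. bdd_borel f \<longrightarrow> (\<forall>x. cmod (f x) \<le> C) \<longrightarrow> cmod (L f) \<le> M * C)"

lemma bounded_functionalI:
  assumes "\<And>f g. bdd_borel f \<Longrightarrow> bdd_borel g \<Longrightarrow> L (\<lambda>x. f x + g x) = L f + L g"
    and "\<And>c f. bdd_borel f \<Longrightarrow> L (\<lambda>x. c * f x) = c * L f"
    and "\<And>f C. bdd_borel f \<Longrightarrow> (\<And>x. cmod (f x) \<le> C) \<Longrightarrow> cmod (L f) \<le> M * C"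
  shows "bounded_functional L"
  using assms unfolding bounded_functional_def by blast

lemma bounded_functionalD:
  assumes "bounded_functional L"
  shows "bdd_borel f \<Longrightarrow> bdd_borel g \<Longrightarrow> L (\<lambda>x. f x + g x) = L f + L g"
    and "bdd_borel f \<Longrightarrow> L (\<lambda>x. c * f x) = c * L f"
  using assms unfolding bounded_functional_def by blast+

lemma bounded_functional_bound:
  assumes "bounded_functional L"
  obtains M where "M \<ge> 0" "\<And>f C. bdd_borel f \<Longrightarrow> (\<And>x. cmod (f x) \<le> C) \<Longrightarrow> cmod (L f) \<le> M * C"
proof -
  obtain M where M: "\<And>f C. bdd_borel f \<Longrightarrow> (\<And>x. cmod (f x) \<le> C) \<Longrightarrow> cmod (L f) \<le> M * C"
    using assms unfolding bounded_functional_def by blast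
  have "0 \<le> M"
    using order_trans[OF norm_ge_zero M[OF bdd_borel_const[of 1], of 1]] by simp
  with M show ?thesis by (rule that[rotated])
qed

lemma bounded_functional_add:
  assumes "bounded_functional L" "bounded_functional L'"
  shows "bounded_functional (\<lambda>f. L f + L' f)"
proof -
  obtain M where M: "\<And>f C. bdd_borel f \<Longrightarrow> (\<And>x. cmod (f x) \<le> C) \<Longrightarrow> cmod (L f) \<le> M * C"
    using bounded_functional_bound[OF assms(1)] by blast
  obtain M' where M': "\<And>f C. bdd_borel f \<Longrightarrow> (\<And>x. cmod (f x) \<le> C) \<Longrightarrow> cmod (L' f) \<le> M' * C"
    using bounded_functional_bound[OF assms(2)] by blast
  show ?thesis
  proof (rule bounded_functionalI[where M = "M + M'"])
    show "cmod (L f + L' f) \<le> (M + M') * C" if "bdd_borel f" "\<And>x. cmod (f x) \<le> C" for f C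
      using norm_triangle_le[OF add_mono[OF M[OF that] M'[OF that]]] by (simp add: algebra_simps)
  qed (simp_all add: assms[THEN bounded_functionalD(1)] assms[THEN bounded_functionalD(2)] algebra_simps)
qed

lemma bounded_functional_scale:
  assumes "bounded_functional L"
  shows "bounded_functional (\<lambda>f. c * L f)"
proof -
  obtain M where M: "\<And>f C. bdd_borel f \<Longrightarrow> (\<And>x. cmod (f x) \<le> C) \<Longrightarrow> cmod (L f) \<le> M * C"
    using bounded_functional_bound[OF assms] by blast
  show ?thesis
  proof (rule bounded_functionalI[where M = "cmod c * M"])
    show "cmod (c * L f) \<le> cmod c * M * C" if "bdd_borel f" "\<And>x. cmod (f x) \<le> C" for f C
      using mult_left_mono[OF M[OF that] norm_ge_zero[of c]] by (simp add: norm_mult mult.assoc)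
  qed (simp_all add: assms[THEN bounded_functionalD(1)] assms[THEN bounded_functionalD(2)] algebra_simps)
qed

lemma bounded_functional_multiplier:
  assumes L: "bounded_functional L" and h: "bdd_borel h"
  shows "bounded_functional (\<lambda>f. L (\<lambda>x. h x * f x))"
proof -
  obtain M where M: "M \<ge> 0" "\<And>f C. bdd_borel f \<Longrightarrow> (\<And>x. cmod (f x) \<le> C) \<Longrightarrow> cmod (L f) \<le> M * C"
    using bounded_functional_bound[OF L] by blast
  obtain D where D: "D \<ge> 0" "\<And>x. cmod (h x) \<le> D" using h by (rule bdd_borelE) blast
  show ?thesis
  proof (rule bounded_functionalI[where M = "M * D"])
    show "cmod (L (\<lambda>x. h x * f x)) \<le> M * D * C" if "bdd_borel f" "\<And>x. cmod (f x) \<le> C" for f C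
      using M(2)[OF bdd_borel_mult[OF h that(1)], of "D * C"] D that(2)
      by (simp add: norm_mult mult_mono mult.assoc)
    show "L (\<lambda>x. h x * (f x + g x)) = L (\<lambda>x. h x * f x) + L (\<lambda>x. h x * g x)"
      if "bdd_borel f" "bdd_borel g" for f g
      using bounded_functionalD(1)[OF L bdd_borel_mult[OF h that(1)] bdd_borel_mult[OF h that(2)]]
      by (simp add: algebra_simps)
    show "L (\<lambda>x. h x * (c * f x)) = c * L (\<lambda>x. h x * f x)" if "bdd_borel f" for c f
      using bounded_functionalD(2)[OF L bdd_borel_mult[OF h that], of c]
      by (simp add: algebra_simps)
  qed
qed

text \<open>Rounding real and imaginary parts to multiples of \<open>1/n\<close> approximates a bounded Borel function
  uniformly by functions with finite range, which are linear combinations of indicators.\<close>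

lemma bounded_functional_zero_on_indicators:
  assumes D: "bounded_functional D" and ind: "\<And>B. B \<in> sets borel \<Longrightarrow> D (indicator B) = 0"
    and f: "bdd_borel f"
  shows "D f = 0"
proof -
  obtain M where M: "M \<ge> 0" "\<And>f C. bdd_borel f \<Longrightarrow> (\<And>x. cmod (f x) \<le> C) \<Longrightarrow> cmod (D f) \<le> M * C"
    using bounded_functional_bound[OF D] by blast
  have D_sum: "D (\<lambda>x. \<Sum>i\<in>I. g i x) = (\<Sum>i\<in>I. D (g i))"
    if "finite I" "\<And>i. i \<in> I \<Longrightarrow> bdd_borel (g i)" for I and g :: "complex \<Rightarrow> real \<Rightarrow> complex"
    using that
  proof (induction I rule: finite_induct)
    case empty
    have "D (\<lambda>x. 0) = 0"
      using bounded_functionalD(2)[OF D bdd_borel_const[of 0], of 0] by simp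
    then show ?case by simp
  next
    case (insert i I)
    then show ?case
      by (simp add: bounded_functionalD(1)[OF D] bdd_borel_sum)
  qed
  have fin: "D g = 0" if g: "g \<in> borel_measurable borel" and "finite (range g)" for g
  proof -
    have m: "g -` {y} \<in> sets borel" for y
      using measurable_sets[OF g, of "{y}"] by simp
    have bdd: "bdd_borel (\<lambda>x. y * indicator (g -` {y}) x)" for y
      using bdd_borel_mult[OF bdd_borel_const bdd_borel_indicator[OF m]] .
    have "g = (\<lambda>x. \<Sum>y\<in>range g. y * indicator (g -` {y}) x)"
    proof
      fix x
      have "(\<Sum>y\<in>range g. y * indicator (g -` {y}) x) = (\<Sum>y\<in>range g. if y = g x then y else 0)"
        by (rule sum.cong) (auto simp: indicator_def)
      then show "g x = (\<Sum>y\<in>range g. y * indicator (g -` {y}) x)"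
        using that(2) by simp
    qed
    then have "D g = (\<Sum>y\<in>range g. D (\<lambda>x. y * indicator (g -` {y}) x))"
      using D_sum[of "range g" "\<lambda>y x. y * indicator (g -` {y}) x"] that(2) bdd by simp
    also have "\<dots> = 0"
      using bounded_functionalD(2)[OF D bdd_borel_indicator[OF m]] ind[OF m] by simp
    finally show ?thesis .
  qed
  obtain C where C: "f \<in> borel_measurable borel" "C \<ge> 0" "\<And>x. cmod (f x) \<le> C"
    using f by (rule bdd_borelE) blast
  have small: "cmod (D f) \<le> M * (2 / real n)" if n: "n > 0" for n :: nat
  proof -
    define g where "g x = Complex (real_of_int \<lfloor>n * Re (f x)\<rfloor> / n) (real_of_int \<lfloor>n * Im (f x)\<rfloor> / n)" for x
    have g: "g \<in> borel_measurable borel"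
      unfolding g_def borel_measurable_complex_iff using C(1) by simp
    define N where "N = \<lceil>n * C\<rceil> + 1"
    have floor_in: "\<lfloor>real n * r\<rfloor> \<in> {-N..N}" if "\<bar>r\<bar> \<le> C" for r
    proof -
      have "\<bar>real n * r\<bar> \<le> n * C" using that by (simp add: abs_mult mult_left_mono)
      then show ?thesis unfolding N_def by (simp add: abs_le_iff) linarith
    qed
    have "range g \<subseteq> (\<lambda>(i, j). Complex (real_of_int i / n) (real_of_int j / n)) ` ({-N..N} \<times> {-N..N})"
    proof
      fix y assume "y \<in> range g"
      then obtain x where "y = g x" by blast
      moreover have "\<bar>Re (f x)\<bar> \<le> C" "\<bar>Im (f x)\<bar> \<le> C"
        using C(3)[of x] abs_Re_le_cmod[of "f x"] abs_Im_le_cmod[of "f x"] by linarith+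
      ultimately show "y \<in> (\<lambda>(i, j). Complex (real_of_int i / n) (real_of_int j / n)) ` ({-N..N} \<times> {-N..N})"
        unfolding g_def
        by (intro image_eqI[where x = "(\<lfloor>real n * Re (f x)\<rfloor>, \<lfloor>real n * Im (f x)\<rfloor>)"])
           (auto dest!: floor_in)
    qed
    then have fr: "finite (range g)" by (rule finite_subset) auto
    have g0: "D g = 0" by (rule fin[OF g fr])
    have bg: "bdd_borel g"
    proof -
      have "finite (range (\<lambda>x. cmod (g x)))"
        using finite_imageI[OF fr, of cmod] by (simp add: image_image)
      then show ?thesis by (intro bdd_borelI[OF g, of "Max (range (\<lambda>x. cmod (g x)))"]) auto
    qed
    define r where "r x = f x + (-1) * g x" for x
    have br: "bdd_borel r"
      unfolding r_def by (intro bdd_borel_add f bdd_borel_mult bdd_borel_const bg)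
    have fl: "\<bar>t - real_of_int \<lfloor>n * t\<rfloor> / n\<bar> \<le> 1 / n" for t :: real
    proof -
      have "\<bar>n * t - real_of_int \<lfloor>n * t\<rfloor>\<bar> \<le> 1" by linarith
      moreover have "t - real_of_int \<lfloor>n * t\<rfloor> / n = (n * t - real_of_int \<lfloor>n * t\<rfloor>) / n"
        using n by (simp add: field_simps)
      ultimately show ?thesis using n by (simp add: divide_right_mono)
    qed
    have rb: "cmod (r x) \<le> 2 / n" for x
    proof -
      have "cmod (r x) \<le> \<bar>Re (r x)\<bar> + \<bar>Im (r x)\<bar>" by (rule cmod_le)
      also have "\<dots> \<le> 1 / n + 1 / n"
        unfolding r_def g_def using fl by (intro add_mono) simp_all
      finally show ?thesis by simp
    qed
    have "D f = D r"
    proof -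
      have "D r = D f + (-1) * D g"
        unfolding r_def
        using bounded_functionalD(1)[OF D f bdd_borel_mult[OF bdd_borel_const[of "-1"] bg]]
          bounded_functionalD(2)[OF D bg, of "-1"] by simp
      then show ?thesis by (simp add: g0)
    qed
    then show ?thesis using M(2)[OF br rb] by simp
  qed
  have "(\<lambda>n. M * (2 / real n)) \<longlonglongrightarrow> M * 0"
    by (intro tendsto_mult_left lim_const_over_n)
  then have "cmod (D f) \<le> M * 0"
    by (rule LIMSEQ_le_const) (use small in \<open>auto intro!: exI[of _ 1]\<close>)
  then show ?thesis by simp
qed

lemma bounded_functional_eqI:
  assumes L: "bounded_functional L" and L': "bounded_functional L'"
    and ind: "\<And>B. B \<in> sets borel \<Longrightarrow> L (indicator B) = L' (indicator B)"
    and f: "bdd_borel f"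
  shows "L f = L' f"
proof -
  have "bounded_functional (\<lambda>f. L f + (-1) * L' f)"
    by (intro bounded_functional_add bounded_functional_scale L L')
  from bounded_functional_zero_on_indicators[OF this _ f] ind show ?thesis by simp
qed


section \<open>The functional calculus of a spectral measure\<close>

lemma sum_lessThan_4: "(\<Sum>k<4. f k) = f 0 + f 1 + f 2 + f (3::nat)" for f :: "nat \<Rightarrow> 'a::comm_monoid_add"
  by (simp add: eval_nat_numeral)

lemma imaginary_unit_powers: "\<i> ^ 2 = -1" "\<i> ^ 3 = -\<i>"
  by (simp_all add: eval_nat_numeral)

lemma cinner_polarization:
  "(1 / 4) * (\<Sum>k<4. \<i> ^ k * of_real ((norm (x + \<i> ^ k *\<^sub>C y))\<^sup>2)) = cinner x y"
  unfolding cinner_self[symmetric] sum_lessThan_4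
  by (simp add: imaginary_unit_powers cinner_add_left cinner_add_right cinner_scale_left
      cinner_scale_right algebra_simps)

text \<open>For a spectral measure \<open>P\<close>, everything rests on \<open>spec_integral P 1\<^sub>B \<phi> \<psi> = \<langle>P B \<phi>, \<psi>\<rangle>\<close>, which is the
  polarization identity. Sesquilinearity and multiplicativity of the calculus are then inherited from
  the projections by comparing functionals on indicators.\<close>

locale spectral_pair =
  fixes T :: "ell2 \<Rightarrow> ell2" and P :: "real set \<Rightarrow> ell2 \<Rightarrow> ell2"
  assumes spectral: "is_spectral_measure T P"
begin

lemma pvm: "projection_valued_measure P"
  using spectral by (simp add: is_spectral_measure_def)

lemma P_projection:
  assumes "B \<in> sets borel"
  shows P_add: "P B (x + y) = P B x + P B y" and P_scale: "P B (c *\<^sub>C x) = c *\<^sub>C P B x"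
    and P_idem: "P B (P B x) = P B x" and P_self_adjoint: "cinner (P B x) y = cinner x (P B y)"
  using pvm assms unfolding projection_valued_measure_def orthogonal_projection_def by blast+

lemma P_UNIV: "P UNIV x = x"
  using pvm unfolding projection_valued_measure_def by simp

lemma P_sums:
  assumes "\<And>n. A n \<in> sets borel" "disjoint_family A"
  shows "(\<lambda>n. P (A n) \<psi>) sums P (\<Union>n::nat. A n) \<psi>"
  using pvm assms unfolding projection_valued_measure_def by blast

lemma P_empty: "P {} x = 0"
proof -
  have "(\<lambda>n::nat. P {} x) sums P (\<Union>n::nat. {}) x"
    by (rule P_sums) (auto simp: disjoint_family_on_def)
  then have "summable (\<lambda>n::nat. P {} x)" by (rule sums_summable)
  then have "(\<lambda>n::nat. P {} x) \<longlonglongrightarrow> 0" by (rule summable_LIMSEQ_zero)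
  then show ?thesis by (simp add: LIMSEQ_const_iff)
qed

lemma P_disjoint_Un:
  assumes [measurable]: "A \<in> sets borel" "B \<in> sets borel" and "A \<inter> B = {}"
  shows "P (A \<union> B) x = P A x + P B x"
proof -
  have "(\<lambda>n. P (binaryset A B n) x) sums P (\<Union>n. binaryset A B n) x"
    by (rule P_sums) (use assms in \<open>auto simp: binaryset_def disjoint_family_on_def\<close>)
  then have 1: "(\<lambda>n. P (binaryset A B n) x) sums P (A \<union> B) x"
    by (simp add: UN_binaryset_eq)
  have "(\<lambda>n. P (binaryset A B n) x) sums (\<Sum>n<2. P (binaryset A B n) x)"
    by (rule sums_finite) (auto simp: binaryset_def P_empty)
  also have "(\<Sum>n<2. P (binaryset A B n) x) = P A x + P B x"
    by (simp add: binaryset_def eval_nat_numeral)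
  finally have 2: "(\<lambda>n. P (binaryset A B n) x) sums (P A x + P B x)" .
  show ?thesis using 1 2 by (rule sums_unique2)
qed

lemma inner_P: "B \<in> sets borel \<Longrightarrow> inner (P B x) x = (norm (P B x))\<^sup>2"
  by (metis P_idem P_self_adjoint inner_ell2_def power2_norm_eq_inner)

lemma norm_P_le: "B \<in> sets borel \<Longrightarrow> norm (P B x) \<le> norm x"
proof -
  assume B: "B \<in> sets borel"
  have "norm (P B x) * norm (P B x) \<le> norm (P B x) * norm x"
    using inner_P[OF B, of x] norm_cauchy_schwarz[of "P B x" x] by (simp add: power2_eq_square)
  then show ?thesis
    by (cases "norm (P B x) = 0") (simp, simp)
qed

text \<open>If \<open>A\<close> and \<open>B\<close> are disjoint and \<open>y\<close> lies in the range of \<open>P A\<close>, then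
  \<open>\<parallel>P (A \<union> B) y\<parallel>\<^sup>2 = \<parallel>y\<parallel>\<^sup>2 + 3 \<parallel>P B y\<parallel>\<^sup>2\<close>, and a projection does not increase the norm.\<close>

lemma P_disjoint:
  assumes A: "A \<in> sets borel" and B: "B \<in> sets borel" and "A \<inter> B = {}"
  shows "P B (P A x) = 0"
proof -
  define y where "y = P A x"
  have "P (A \<union> B) y = y + P B y"
    using P_disjoint_Un[OF assms] P_idem[OF A] by (simp add: y_def)
  then have "(norm (P (A \<union> B) y))\<^sup>2 = (norm y)\<^sup>2 + (norm (P B y))\<^sup>2 + 2 * inner (P B y) y"
    by (simp add: power2_norm_eq_inner inner_add_left inner_add_right inner_commute)
  also have "\<dots> = (norm y)\<^sup>2 + 3 * (norm (P B y))\<^sup>2" using inner_P[OF B] by simp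
  finally have "(norm (P (A \<union> B) y))\<^sup>2 = (norm y)\<^sup>2 + 3 * (norm (P B y))\<^sup>2" .
  moreover have "(norm (P (A \<union> B) y))\<^sup>2 \<le> (norm y)\<^sup>2"
    using A B by (intro power_mono norm_P_le) auto
  ultimately have "(norm (P B y))\<^sup>2 \<le> 0" by simp
  then show ?thesis by (simp add: y_def)
qed

lemma P_Int:
  assumes [measurable]: "A \<in> sets borel" "B \<in> sets borel"
  shows "P B (P A x) = P (A \<inter> B) x"
proof -
  have "P A x = P (A \<inter> B) x + P (A - B) x"
    using P_disjoint_Un[of "A \<inter> B" "A - B" x] by (simp add: Int_Diff_Un Int_Diff_disjoint)
  moreover have "P B (P (A \<inter> B) x) = P (A \<inter> B) (P (A \<inter> B) x) + P (B - A) (P (A \<inter> B) x)"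
    using P_disjoint_Un[of "A \<inter> B" "B - A" "P (A \<inter> B) x"]
    by (simp add: Int_commute[of A B] Int_Diff_Un Int_Diff_disjoint)
  moreover have "P (B - A) (P (A \<inter> B) x) = 0" by (rule P_disjoint) auto
  moreover have "P B (P (A - B) x) = 0" by (rule P_disjoint) auto
  ultimately show ?thesis by (simp add: P_add P_idem)
qed

lemma sets_spec_meas [simp, measurable_cong]: "sets (spec_meas P \<phi>) = sets borel"
  unfolding spec_meas_def using sets.sigma_sets_eq[of "borel :: real measure"]
  by (simp add: sets_measure_of)

lemma space_spec_meas [simp]: "space (spec_meas P \<phi>) = UNIV"
  unfolding spec_meas_def by (simp add: space_measure_of)

lemma emeasure_spec_meas:
  assumes "B \<in> sets borel"
  shows "emeasure (spec_meas P \<phi>) B = ennreal ((norm (P B \<phi>))\<^sup>2)"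
proof -
  have "emeasure (spec_meas P \<phi>) B = ennreal (Re (cinner (P B \<phi>) \<phi>))"
    unfolding spec_meas_def
  proof (rule emeasure_measure_of_sigma[where \<Omega> = UNIV and M = "sets borel"])
    show "sigma_algebra UNIV (sets (borel :: real measure))"
      using sets.sigma_algebra_axioms[of "borel :: real measure"] by simp
    show "positive (sets borel) (\<lambda>B. ennreal (Re (cinner (P B \<phi>) \<phi>)))"
      by (simp add: positive_def P_empty)
    show "countably_additive (sets borel) (\<lambda>B. ennreal (Re (cinner (P B \<phi>) \<phi>)))"
    proof (rule countably_additiveI)
      fix A :: "nat \<Rightarrow> real set"
      assume A: "range A \<subseteq> sets borel" "disjoint_family A"
      have "(\<lambda>n. inner (P (A n) \<phi>) \<phi>) sums inner (P (\<Union>n. A n) \<phi>) \<phi>"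
        using A by (intro bounded_linear.sums[OF bounded_linear_inner_left] P_sums) auto
      then show "(\<Sum>n. ennreal (Re (cinner (P (A n) \<phi>) \<phi>))) = ennreal (Re (cinner (P (\<Union> (range A)) \<phi>) \<phi>))"
        unfolding inner_ell2_def[symmetric]
        using A inner_P by (intro suminf_ennreal_eq) (auto simp: image_subset_iff)
    qed
  qed (rule assms)
  then show ?thesis using inner_P[OF assms] by (simp add: inner_ell2_def)
qed

lemma finite_spec_meas: "finite_measure (spec_meas P \<phi>)"
  by (rule finite_measureI) (simp add: emeasure_spec_meas)

lemma measure_spec_meas: "B \<in> sets borel \<Longrightarrow> measure (spec_meas P \<phi>) B = (norm (P B \<phi>))\<^sup>2"
  by (simp add: measure_def emeasure_spec_meas)

lemma integrable_bdd_borel: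
  assumes "bdd_borel f"
  shows "integrable (spec_meas P \<phi>) f"
proof -
  interpret finite_measure "spec_meas P \<phi>" by (rule finite_spec_meas)
  obtain C where "f \<in> borel_measurable borel" "\<And>x. cmod (f x) \<le> C"
    using assms by (rule bdd_borelE) blast
  then show ?thesis by (intro integrable_const_bound[where B = C]) auto
qed

lemma bounded_functional_integral: "bounded_functional (\<lambda>f. integral\<^sup>L (spec_meas P \<phi>) f)"
proof (rule bounded_functionalI[where M = "measure (spec_meas P \<phi>) UNIV"])
  fix f C assume f: "bdd_borel f" and C: "\<And>x. cmod (f x) \<le> C"
  interpret finite_measure "spec_meas P \<phi>" by (rule finite_spec_meas)
  have "cmod (integral\<^sup>L (spec_meas P \<phi>) f) \<le> (\<integral>x. cmod (f x) \<partial>spec_meas P \<phi>)"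
    by (rule integral_norm_bound)
  also have "\<dots> \<le> (\<integral>x. C \<partial>spec_meas P \<phi>)"
    by (rule integral_mono) (use integrable_bdd_borel[OF f] C in auto)
  finally show "cmod (integral\<^sup>L (spec_meas P \<phi>) f) \<le> measure (spec_meas P \<phi>) UNIV * C"
    by simp
qed (simp_all add: integrable_bdd_borel)

lemma spec_integral_expand:
  "spec_integral P f \<phi> \<psi> = 1 / 4 * integral\<^sup>L (spec_meas P (\<phi> + \<psi>)) f + \<i> / 4 * integral\<^sup>L (spec_meas P (\<phi> + \<i> *\<^sub>C \<psi>)) f
    + (- 1 / 4) * integral\<^sup>L (spec_meas P (\<phi> + (-1) *\<^sub>C \<psi>)) f + (- \<i> / 4) * integral\<^sup>L (spec_meas P (\<phi> + (-\<i>) *\<^sub>C \<psi>)) f"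
  unfolding spec_integral_def sum_lessThan_4 by (simp add: imaginary_unit_powers algebra_simps)

lemma bounded_functional_spec_integral: "bounded_functional (\<lambda>f. spec_integral P f \<phi> \<psi>)"
  unfolding spec_integral_expand
  by (intro bounded_functional_add bounded_functional_scale bounded_functional_integral)

lemma spec_integral_indicator:
  assumes "B \<in> sets borel"
  shows "spec_integral P (indicator B) \<phi> \<psi> = cinner (P B \<phi>) \<psi>"
proof -
  have "integral\<^sup>L (spec_meas P \<phi>) (indicator B :: real \<Rightarrow> complex) = of_real ((norm (P B \<phi>))\<^sup>2)" for \<phi>
  proof -
    interpret finite_measure "spec_meas P \<phi>" by (rule finite_spec_meas)
    have "integral\<^sup>L (spec_meas P \<phi>) (indicator B :: real \<Rightarrow> complex) =
        (\<integral>x. of_real (indicator B x) \<partial>spec_meas P \<phi>)"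
      by (rule Bochner_Integration.integral_cong) (auto simp: indicator_def)
    also have "\<dots> = of_real (\<integral>x. indicator B x \<partial>spec_meas P \<phi>)" 
      by (rule integral_of_real, rule integrable_real_indicator) (use assms in \<open>auto simp: emeasure_spec_meas\<close>)
    also have "(\<integral>x. indicator B x \<partial>spec_meas P \<phi>) = measure (spec_meas P \<phi>) B"
      by simp
    finally show ?thesis using assms by (simp add: measure_spec_meas)
  qed
  then have "spec_integral P (indicator B) \<phi> \<psi>
      = (1 / 4) * (\<Sum>k<4. \<i> ^ k * of_real ((norm (P B \<phi> + \<i> ^ k *\<^sub>C P B \<psi>))\<^sup>2))"
    unfolding spec_integral_def by (simp only: P_add[OF assms] P_scale[OF assms])
  also have "\<dots> = cinner (P B \<phi>) (P B \<psi>)" by (rule cinner_polarization)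
  also have "\<dots> = cinner (P B \<phi>) \<psi>" using P_self_adjoint P_idem assms by metis
  finally show ?thesis .
qed

lemmas spec_integral_linear = bounded_functionalD[OF bounded_functional_spec_integral]

lemma spec_integral_add_left:
  assumes "bdd_borel f"
  shows "spec_integral P f (\<phi> + \<phi>') \<psi> = spec_integral P f \<phi> \<psi> + spec_integral P f \<phi>' \<psi>"
  by (rule bounded_functional_eqI[OF _ _ _ assms])
     (auto intro!: bounded_functional_spec_integral bounded_functional_add
           simp: spec_integral_indicator P_add cinner_add_left)

lemma spec_integral_scale_left:
  assumes "bdd_borel f"
  shows "spec_integral P f (c *\<^sub>C \<phi>) \<psi> = c * spec_integral P f \<phi> \<psi>"
  by (rule bounded_functional_eqI[OF _ _ _ assms])
     (auto intro!: bounded_functional_spec_integral bounded_functional_scale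
           simp: spec_integral_indicator P_scale cinner_scale_left)

lemma spec_integral_add_right:
  assumes "bdd_borel f"
  shows "spec_integral P f \<phi> (\<psi> + \<psi>') = spec_integral P f \<phi> \<psi> + spec_integral P f \<phi> \<psi>'"
  by (rule bounded_functional_eqI[OF _ _ _ assms])
     (auto intro!: bounded_functional_spec_integral bounded_functional_add
           simp: spec_integral_indicator cinner_add_right)

lemma spec_integral_scale_right:
  assumes "bdd_borel f"
  shows "spec_integral P f \<phi> (c *\<^sub>C \<psi>) = cnj c * spec_integral P f \<phi> \<psi>"
  by (rule bounded_functional_eqI[OF _ _ _ assms])
     (auto intro!: bounded_functional_spec_integral bounded_functional_scale
           simp: spec_integral_indicator cinner_scale_right)

text \<open>On unit vectors the four terms of the polarization formula are each at most
  \<open>\<parallel>\<phi> + i\<^sup>k \<psi>\<parallel>\<^sup>2 / 4 \<le> 1\<close> times the supremum of \<open>f\<close>; sesquilinearity does the rest.\<close>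

lemma norm_spec_integral_le:
  assumes f: "bdd_borel f" and C: "\<And>x. cmod (f x) \<le> C"
  shows "cmod (spec_integral P f \<phi> \<psi>) \<le> 4 * C * norm \<phi> * norm \<psi>"
proof -
  have C0: "C \<ge> 0" using order_trans[OF norm_ge_zero C] .
  have unit: "cmod (spec_integral P f u v) \<le> 4 * C" if uv: "norm u = 1" "norm v = 1" for u v
  proof -
    have summand: "cmod (\<i> ^ k * integral\<^sup>L (spec_meas P (u + \<i> ^ k *\<^sub>C v)) f) \<le> 4 * C" for k
    proof -
      let ?w = "u + \<i> ^ k *\<^sub>C v"
      have "norm ?w \<le> 2"
        using norm_triangle_ineq[of u "\<i> ^ k *\<^sub>C v"] uv by (simp add: norm_scaleC norm_power)
      then have w: "(norm ?w)\<^sup>2 \<le> 4"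
        using power_mono[of "norm ?w" 2 2] by simp
      interpret finite_measure "spec_meas P ?w" by (rule finite_spec_meas)
      have "cmod (integral\<^sup>L (spec_meas P ?w) f) \<le> (\<integral>x. cmod (f x) \<partial>spec_meas P ?w)"
        by (rule integral_norm_bound)
      also have "\<dots> \<le> (\<integral>x. C \<partial>spec_meas P ?w)"
        by (rule integral_mono) (use integrable_bdd_borel[OF f] C in auto)
      also have "\<dots> = (norm ?w)\<^sup>2 * C"
        by (simp add: measure_spec_meas P_UNIV)
      also have "\<dots> \<le> 4 * C" using w C0 by (rule mult_right_mono)
      finally show ?thesis by (simp add: norm_mult norm_power)
    qed
    have "cmod (\<Sum>k<4. \<i> ^ k * integral\<^sup>L (spec_meas P (u + \<i> ^ k *\<^sub>C v)) f) \<le> (\<Sum>k<4::nat. 4 * C)"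
      by (rule sum_norm_le) (rule summand)
    then show ?thesis unfolding spec_integral_def norm_mult by simp
  qed
  show ?thesis
  proof (cases "\<phi> = 0 \<or> \<psi> = 0")
    case True
    then have "spec_integral P f \<phi> \<psi> = 0"
      using spec_integral_scale_left[OF f, of 0 \<phi> \<psi>] spec_integral_scale_right[OF f, of \<phi> 0 \<psi>] by auto
    then show ?thesis using C0 by simp
  next
    case False
    define u where "u = of_real (inverse (norm \<phi>)) *\<^sub>C \<phi>"
    define v where "v = of_real (inverse (norm \<psi>)) *\<^sub>C \<psi>"
    have "norm u = 1" "norm v = 1" using False by (simp_all add: u_def v_def norm_scaleC norm_inverse)
    then have "cmod (spec_integral P f u v) \<le> 4 * C" by (rule unit)
    moreover have "spec_integral P f \<phi> \<psi> = of_real (norm \<phi> * norm \<psi>) * spec_integral P f u v"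
      unfolding u_def v_def spec_integral_scale_left[OF f] spec_integral_scale_right[OF f]
      using False by (simp add: field_simps)
    ultimately have "cmod (spec_integral P f \<phi> \<psi>) \<le> (norm \<phi> * norm \<psi>) * (4 * C)"
      by (simp add: norm_mult mult_left_mono)
    then show ?thesis by (simp add: mult_ac)
  qed
qed

abbreviation calc :: "(real \<Rightarrow> complex) \<Rightarrow> ell2 \<Rightarrow> ell2"
  where "calc \<equiv> functional_calculus P"

lemma calc_unique:
  assumes "\<And>\<psi>. cinner \<eta> \<psi> = spec_integral P f \<phi> \<psi>"
  shows "calc f \<phi> = \<eta>"
  unfolding functional_calculus_def
  by (rule the_equality) (use assms in \<open>auto intro: cinner_ext\<close>)

text \<open>The vector described by the functional calculus exists by the Riesz representation theorem.\<close>

lemma cinner_calc: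
  assumes f: "bdd_borel f"
  shows "cinner (calc f \<phi>) \<psi> = spec_integral P f \<phi> \<psi>"
proof -
  obtain C where C: "C \<ge> 0" "\<And>x. cmod (f x) \<le> C" using f by (rule bdd_borelE) blast
  have "\<exists>\<eta>. \<forall>\<psi>. cinner \<eta> \<psi> = spec_integral P f \<phi> \<psi>"
    by (rule riesz_representation[where C = "4 * C * norm \<phi>"])
       (simp_all add: spec_integral_add_right spec_integral_scale_right f norm_spec_integral_le C)
  then obtain \<eta> where "\<And>\<psi>. cinner \<eta> \<psi> = spec_integral P f \<phi> \<psi>" by blast
  then show ?thesis using calc_unique[of \<eta> f \<phi>] by simp
qed

text \<open>The constant 4, in place of the sharp constant 1, comes from bounding the polarization formula term
  by term.\<close>

lemma norm_calc_le:
  assumes f: "bdd_borel f" and C: "\<And>x. cmod (f x) \<le> C"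
  shows "norm (calc f \<phi>) \<le> 4 * C * norm \<phi>"
proof -
  have C0: "C \<ge> 0" using order_trans[OF norm_ge_zero C] .
  have "norm (calc f \<phi>) * norm (calc f \<phi>) = cmod (cinner (calc f \<phi>) (calc f \<phi>))"
    by (simp add: cinner_self power2_eq_square norm_mult)
  also have "\<dots> \<le> 4 * C * norm \<phi> * norm (calc f \<phi>)"
    unfolding cinner_calc[OF f] by (rule norm_spec_integral_le[OF f C])
  finally show ?thesis
    by (cases "norm (calc f \<phi>) = 0") (simp_all add: C0)
qed

lemma calc_indicator: "B \<in> sets borel \<Longrightarrow> calc (indicator B) \<phi> = P B \<phi>"
  by (rule calc_unique) (simp add: spec_integral_indicator)

lemma calc_add_right: "bdd_borel f \<Longrightarrow> calc f (\<phi> + \<psi>) = calc f \<phi> + calc f \<psi>"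
  by (rule calc_unique) (simp add: cinner_add_left cinner_calc spec_integral_add_left)

lemma calc_scale_right: "bdd_borel f \<Longrightarrow> calc f (c *\<^sub>C \<phi>) = c *\<^sub>C calc f \<phi>"
  by (rule calc_unique) (simp add: cinner_scale_left cinner_calc spec_integral_scale_left)

lemma calc_add: "bdd_borel f \<Longrightarrow> bdd_borel g \<Longrightarrow> calc (\<lambda>x. f x + g x) \<phi> = calc f \<phi> + calc g \<phi>"
  by (rule calc_unique) (simp add: cinner_add_left cinner_calc spec_integral_linear)

lemma calc_scale: "bdd_borel f \<Longrightarrow> calc (\<lambda>x. c * f x) \<phi> = c *\<^sub>C calc f \<phi>"
  by (rule calc_unique) (simp add: cinner_scale_left cinner_calc spec_integral_linear)

text \<open>Both multiplicativity statements compare two functionals of one function, the other function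
  being fixed. For \<open>f\<close> an indicator, the first is \<open>P A P B = P (A \<inter> B)\<close> and the second reduces to the
  first by self-adjointness of the projections.\<close>

lemma spec_integral_mult_indicator:
  assumes f: "bdd_borel f" and B: "B \<in> sets borel"
  shows "spec_integral P (\<lambda>x. indicator B x * f x) \<phi> \<psi> = spec_integral P f \<phi> (P B \<psi>)"
proof (rule bounded_functional_eqI[OF _ _ _ f])
  fix A :: "real set" assume A: "A \<in> sets borel"
  have "(\<lambda>x. indicator B x * indicator A x :: complex) = indicator (A \<inter> B)"
    by (auto simp: indicator_def)
  then show "spec_integral P (\<lambda>x. indicator B x * indicator A x) \<phi> \<psi> = spec_integral P (indicator A) \<phi> (P B \<psi>)"
    using A B by (simp add: spec_integral_indicator P_Int flip: P_self_adjoint)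
qed (intro bounded_functional_multiplier bounded_functional_spec_integral bdd_borel_indicator B)+

lemma spec_integral_mult:
  assumes f: "bdd_borel f" and h: "bdd_borel h"
  shows "spec_integral P (\<lambda>x. h x * f x) \<phi> \<psi> = spec_integral P f (calc h \<phi>) \<psi>"
proof (rule bounded_functional_eqI[OF _ _ _ f])
  fix B :: "real set" assume B: "B \<in> sets borel"
  have "spec_integral P (\<lambda>x. h x * indicator B x) \<phi> \<psi> = spec_integral P h \<phi> (P B \<psi>)"
    using spec_integral_mult_indicator[OF h B] by (simp add: mult.commute)
  then show "spec_integral P (\<lambda>x. h x * indicator B x) \<phi> \<psi> = spec_integral P (indicator B) (calc h \<phi>) \<psi>"
    by (simp add: spec_integral_indicator B P_self_adjoint cinner_calc h)
qed (intro bounded_functional_multiplier bounded_functional_spec_integral h)+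

lemma calc_mult: "bdd_borel f \<Longrightarrow> bdd_borel h \<Longrightarrow> calc (\<lambda>x. h x * f x) \<phi> = calc f (calc h \<phi>)"
  by (rule calc_unique) (simp add: cinner_calc spec_integral_mult)

end


section \<open>Continuous functions of a bounded operator\<close>

context spectral_pair
begin

text \<open>The monomials, and with them the identity function that represents \<open>T\<close>, are unbounded on the real
  line. A compact set of full spectral measure is therefore fixed once and for all, and continuous
  functions are cut off outside it.\<close>

definition supp :: "real set"
  where "supp = (SOME K. compact K \<and> P K = id)"

lemma supp: "compact supp" "P supp \<phi> = \<phi>"
  using someI_ex[of "\<lambda>K. compact K \<and> P K = id"] spectral
  by (auto simp: supp_def is_spectral_measure_def)

lemma supp_borel: "supp \<in> sets borel"
  using supp(1) by (rule borel_compact)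

lemma spec_integral_cong_supp:
  assumes "f \<in> borel_measurable borel" "g \<in> borel_measurable borel"
    and eq: "\<And>x. x \<in> supp \<Longrightarrow> f x = g x"
  shows "spec_integral P f \<phi> \<psi> = spec_integral P g \<phi> \<psi>"
proof -
  have "P (- supp) \<phi> = 0" for \<phi>
    using P_disjoint[of supp "- supp" \<phi>] supp_borel by (simp add: supp)
  then have null: "- supp \<in> null_sets (spec_meas P \<phi>)" for \<phi>
    using supp_borel by (simp add: null_sets_def emeasure_spec_meas)
  have "integral\<^sup>L (spec_meas P \<phi>) f = integral\<^sup>L (spec_meas P \<phi>) g" for \<phi>
    using assms(1,2) eq by (intro integral_cong_AE AE_I'[OF null]) auto
  then show ?thesis by (simp add: spec_integral_def)
qed

lemma calc_cong_supp:
  assumes "f \<in> borel_measurable borel" "g \<in> borel_measurable borel"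
    and "\<And>x. x \<in> supp \<Longrightarrow> f x = g x"
  shows "calc f \<phi> = calc g \<phi>"
  by (simp only: functional_calculus_def spec_integral_cong_supp[OF assms])

definition cut :: "(real \<Rightarrow> complex) \<Rightarrow> real \<Rightarrow> complex"
  where "cut f = (\<lambda>x. indicator supp x * f x)"

lemma cut_simp: "x \<in> supp \<Longrightarrow> cut f x = f x" "x \<notin> supp \<Longrightarrow> cut f x = 0"
  by (simp_all add: cut_def)

lemma bdd_borel_cut:
  assumes "continuous_on UNIV f"
  shows "bdd_borel (cut f)"
proof -
  have "compact (f ` supp)"
    using supp(1) assms by (intro compact_continuous_image continuous_on_subset[OF assms]) auto
  then obtain C where C: "\<And>x. x \<in> supp \<Longrightarrow> cmod (f x) \<le> C"
    using compact_imp_bounded[of "f ` supp"] by (auto simp: bounded_iff)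
  show ?thesis
  proof (rule bdd_borelI)
    show "cut f \<in> borel_measurable borel"
      unfolding cut_def using borel_measurable_continuous_onI[OF assms] supp_borel by measurable
    show "cmod (cut f x) \<le> max C 0" for x
      using C[of x] by (cases "x \<in> supp") (auto simp: cut_simp)
  qed
qed

lemma calc_cut:
  assumes "continuous_on UNIV f"
  shows "calc f \<phi> = calc (cut f) \<phi>"
  using borel_measurable_continuous_onI[OF assms] bdd_borel_cut[OF assms]
  by (intro calc_cong_supp) (auto simp: cut_simp bdd_borel_def)

lemma T_eq_calc: "T \<phi> = calc (cut of_real) \<phi>"
proof -
  have c: "continuous_on UNIV (of_real :: real \<Rightarrow> complex)" by (intro continuous_intros)
  have "calc of_real \<phi> = T \<phi>"
    using spectral by (intro calc_unique) (simp add: is_spectral_measure_def)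
  then show ?thesis by (simp only: calc_cut[OF c])
qed

lemma bdd_borel_cut_id: "bdd_borel (cut of_real)"
  by (intro bdd_borel_cut continuous_intros)

lemma T_add: "T (\<phi> + \<psi>) = T \<phi> + T \<psi>"
  unfolding T_eq_calc by (rule calc_add_right[OF bdd_borel_cut_id])

lemma T_scale: "T (c *\<^sub>C \<phi>) = c *\<^sub>C T \<phi>"
  unfolding T_eq_calc by (rule calc_scale_right[OF bdd_borel_cut_id])

lemma T_diff: "T (\<phi> - \<psi>) = T \<phi> - T \<psi>"
  by (simp only: diff_conv_add_uminus uminus_scaleC T_add T_scale)

lemma calc_diff_right: "bdd_borel f \<Longrightarrow> calc f (\<phi> - \<psi>) = calc f \<phi> - calc f \<psi>"
  by (simp only: diff_conv_add_uminus uminus_scaleC calc_add_right calc_scale_right)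

lemma calc_continuous_linear:
  assumes f: "continuous_on UNIV f" and g: "continuous_on UNIV g"
  shows calc_continuous_add: "calc (\<lambda>x. f x + g x) \<phi> = calc f \<phi> + calc g \<phi>"
    and calc_continuous_scale: "calc (\<lambda>x. c * f x) \<phi> = c *\<^sub>C calc f \<phi>"
proof -
  have "calc (\<lambda>x. f x + g x) \<phi> = calc (cut (\<lambda>x. f x + g x)) \<phi>"
    by (intro calc_cut continuous_intros f g)
  also have "cut (\<lambda>x. f x + g x) = (\<lambda>x. cut f x + cut g x)"
    by (auto simp: cut_def algebra_simps)
  finally show "calc (\<lambda>x. f x + g x) \<phi> = calc f \<phi> + calc g \<phi>"
    by (simp add: calc_add bdd_borel_cut f g calc_cut[OF f] calc_cut[OF g])
  have "calc (\<lambda>x. c * f x) \<phi> = calc (cut (\<lambda>x. c * f x)) \<phi>"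
    by (intro calc_cut continuous_intros f)
  also have "cut (\<lambda>x. c * f x) = (\<lambda>x. c * cut f x)"
    by (auto simp: cut_def algebra_simps)
  finally show "calc (\<lambda>x. c * f x) \<phi> = c *\<^sub>C calc f \<phi>"
    by (simp add: calc_scale bdd_borel_cut f calc_cut[OF f])
qed

lemma calc_sum:
  assumes "\<And>i. i \<in> I \<Longrightarrow> continuous_on UNIV (f i)"
  shows "calc (\<lambda>x. \<Sum>i\<in>I. c i * f i x) \<phi> = (\<Sum>i\<in>I. c i *\<^sub>C calc (f i) \<phi>)"
  using assms
proof (induction I rule: infinite_finite_induct)
  case (insert i I)
  have "continuous_on UNIV (\<lambda>x. c i * f i x)" "continuous_on UNIV (\<lambda>x. \<Sum>i\<in>I. c i * f i x)"
    using insert.prems by (auto intro!: continuous_intros)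
  then show ?case
    using insert by (simp add: calc_continuous_add calc_continuous_scale)
qed (use calc_scale[OF bdd_borel_const[of 0], of 0 \<phi>] in simp_all)

lemma calc_tendsto:
  assumes lim: "uniform_limit supp f g sequentially"
    and f: "\<And>n. continuous_on UNIV (f n)" and g: "continuous_on UNIV g"
  shows "(\<lambda>n. calc (f n) \<phi>) \<longlonglongrightarrow> calc g \<phi>"
proof (rule metric_LIMSEQ_I)
  fix r :: real assume "r > 0"
  define e where "e = r / (4 * norm \<phi> + 1)"
  have pos: "4 * norm \<phi> + 1 > 0" by (rule add_nonneg_pos) auto
  then have e0: "e > 0" using \<open>r > 0\<close> by (simp add: e_def)
  have "e * (4 * norm \<phi> + 1) = r" using pos by (simp add: e_def)
  then have "4 * e * norm \<phi> = r - e" by (simp add: algebra_simps)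
  with e0 have e: "e > 0" "4 * e * norm \<phi> < r" by auto
  from lim e(1) obtain N where N: "\<And>n x. n \<ge> N \<Longrightarrow> x \<in> supp \<Longrightarrow> dist (f n x) (g x) < e"
    unfolding uniform_limit_iff eventually_sequentially by blast
  have "dist (calc (f n) \<phi>) (calc g \<phi>) < r" if n: "n \<ge> N" for n
  proof -
    have c: "continuous_on UNIV (\<lambda>x. f n x + (-1) * g x)" by (intro continuous_intros f g)
    have "calc (\<lambda>x. f n x + (-1) * g x) \<phi> = calc (f n) \<phi> + (-1) *\<^sub>C calc g \<phi>"
      by (simp only: calc_continuous_add[OF f continuous_on_mult_left[OF g]] calc_continuous_scale[OF g g])
    then have "calc (f n) \<phi> - calc g \<phi> = calc (cut (\<lambda>x. f n x + (-1) * g x)) \<phi>"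
      by (simp only: calc_cut[OF c] diff_conv_add_uminus uminus_scaleC)
    also have "norm \<dots> \<le> 4 * e * norm \<phi>"
    proof (rule norm_calc_le[OF bdd_borel_cut[OF c]])
      show "cmod (cut (\<lambda>x. f n x + (-1) * g x) x) \<le> e" for x
        using N[OF n, of x] e(1) by (cases "x \<in> supp") (simp_all add: cut_simp dist_norm)
    qed
    finally show ?thesis using e(2) by (simp add: dist_norm)
  qed
  then show "\<exists>N. \<forall>n\<ge>N. dist (calc (f n) \<phi>) (calc g \<phi>) < r" by blast
qed

lemma calc_one: "calc (\<lambda>_. 1) \<phi> = \<phi>"
proof -
  have "calc (\<lambda>_. 1) \<phi> = calc (indicator UNIV) \<phi>" by (rule calc_cong_supp) auto
  also have "\<dots> = P UNIV \<phi>" by (rule calc_indicator) simp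
  finally show ?thesis by (simp only: P_UNIV)
qed

lemma calc_monomial: "calc (\<lambda>x. of_real x ^ n) \<phi> = (T ^^ n) \<phi>"
proof (induction n)
  case 0
  show ?case by (simp add: calc_one)
next
  case (Suc n)
  have c: "continuous_on UNIV (\<lambda>x::real. of_real x ^ k :: complex)" for k by (intro continuous_intros)
  have "cut (\<lambda>x. of_real x ^ Suc n) = (\<lambda>x. cut (\<lambda>x. of_real x ^ n) x * cut of_real x)"
    by (auto simp: cut_def indicator_def)
  then have "calc (\<lambda>x. of_real x ^ Suc n) \<phi> = calc (cut of_real) (calc (cut (\<lambda>x. of_real x ^ n)) \<phi>)"
    unfolding calc_cut[OF c] by (simp add: calc_mult bdd_borel_cut_id bdd_borel_cut[OF c])
  then show ?case by (simp add: T_eq_calc[symmetric] calc_cut[OF c, symmetric] Suc)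
qed

text \<open>The exponential series converges uniformly on the compact support, so the unitary group
  is the strong limit of polynomials in \<open>T\<close>.\<close>

lemma calc_exp_tendsto:
  "(\<lambda>N. \<Sum>n<N. ((\<i> * of_real t) ^ n / fact n) *\<^sub>C (T ^^ n) \<phi>) \<longlonglongrightarrow> calc (\<lambda>x. exp (\<i> * of_real t * of_real x)) \<phi>"
proof -
  define s where "s N x = (\<Sum>n<N. ((\<i> * of_real t) ^ n / fact n) * of_real x ^ n)" for N and x :: real
  obtain R where R: "\<And>x. x \<in> supp \<Longrightarrow> \<bar>x\<bar> \<le> R"
    using compact_imp_bounded[OF supp(1)] unfolding bounded_iff real_norm_def by blast
  have "uniform_limit supp s (\<lambda>x. \<Sum>n. ((\<i> * of_real t) ^ n / fact n) * of_real x ^ n) sequentially"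
    unfolding s_def
  proof (rule Weierstrass_m_test)
    show "summable (\<lambda>n. (\<bar>t\<bar> * R) ^ n /\<^sub>R fact n)" by (rule summable_exp_generic)
    show "cmod (((\<i> * of_real t) ^ n / fact n) * of_real x ^ n) \<le> (\<bar>t\<bar> * R) ^ n /\<^sub>R fact n"
      if "x \<in> supp" for n x
    proof -
      have "cmod (((\<i> * of_real t) ^ n / fact n) * of_real x ^ n) = (\<bar>t\<bar> ^ n / fact n) * \<bar>x\<bar> ^ n"
        by (simp add: norm_mult norm_divide norm_power)
      also have "\<dots> \<le> (\<bar>t\<bar> ^ n / fact n) * R ^ n"
        using R[OF that] by (intro mult_left_mono power_mono) auto
      finally show ?thesis by (simp add: power_mult_distrib divide_inverse mult_ac)
    qed
  qed
  moreover have "(\<Sum>n. ((\<i> * of_real t) ^ n / fact n) * of_real x ^ n) = exp (\<i> * of_real t * of_real x)" for x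
    by (simp add: exp_def scaleR_conv_of_real power_mult_distrib divide_inverse mult_ac)
  ultimately have "uniform_limit supp s (\<lambda>x. exp (\<i> * of_real t * of_real x)) sequentially"
    by simp
  then have "(\<lambda>N. calc (s N) \<phi>) \<longlonglongrightarrow> calc (\<lambda>x. exp (\<i> * of_real t * of_real x)) \<phi>"
    by (rule calc_tendsto) (auto simp: s_def intro!: continuous_intros)
  moreover have "calc (s N) \<phi> = (\<Sum>n<N. ((\<i> * of_real t) ^ n / fact n) *\<^sub>C (T ^^ n) \<phi>)" for N
    unfolding s_def by (subst calc_sum) (auto intro!: continuous_intros simp: calc_monomial)
  ultimately show ?thesis by simp
qed

lemma P_calc:
  assumes f: "bdd_borel f" and A: "A \<in> sets borel"
  shows "P A (calc f \<phi>) = calc f (P A \<phi>)"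
  using calc_mult[OF f bdd_borel_indicator[OF A]] calc_mult[OF bdd_borel_indicator[OF A] f]
  by (simp add: calc_indicator A mult.commute)

lemma P_T: "A \<in> sets borel \<Longrightarrow> P A (T \<phi>) = T (P A \<phi>)"
  unfolding T_eq_calc by (rule P_calc[OF bdd_borel_cut_id])

lemma P_T_power: "A \<in> sets borel \<Longrightarrow> P A ((T ^^ n) \<phi>) = (T ^^ n) (P A \<phi>)"
  by (induction n) (simp_all add: P_T)

end

lemma resolvent_fun:
  assumes "Im z > 0"
  shows bdd_borel_resolvent: "bdd_borel (\<lambda>x. inverse (of_real x - z))"
    and resolvent_nonzero: "complex_of_real x - z \<noteq> 0"
    and norm_resolvent: "cmod (inverse (of_real x - z)) \<le> 1 / Im z"
    and continuous_resolvent: "continuous_on UNIV (\<lambda>x::real. inverse (of_real x - z))"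
proof -
  have nz: "complex_of_real x - z \<noteq> 0" for x using assms by (auto simp: complex_eq_iff)
  then show "complex_of_real x - z \<noteq> 0" .
  have le: "cmod (inverse (of_real x - z)) \<le> 1 / Im z" for x :: real
  proof -
    have "Im z \<le> cmod (of_real x - z)"
      using abs_Im_le_cmod[of "of_real x - z"] assms by simp
    then show ?thesis using assms by (simp add: norm_inverse divide_inverse le_imp_inverse_le)
  qed
  then show "cmod (inverse (of_real x - z)) \<le> 1 / Im z" .
  show "continuous_on UNIV (\<lambda>x::real. inverse (of_real x - z))"
    using nz by (intro continuous_intros) auto
  then show "bdd_borel (\<lambda>x. inverse (of_real x - z))"
    by (intro bdd_borelI[OF borel_measurable_continuous_onI le])
qed

context spectral_pair
begin

text \<open>On the compact support, \<open>x r(x) - z r(x) = 1\<close>; the two equations are the two orders in which \<open>x r(x)\<close>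
  can be factored.\<close>

lemma resolvent_equation:
  assumes z: "Im z > 0"
  defines "r \<equiv> \<lambda>x. inverse (complex_of_real x - z)"
  shows resolvent_left: "calc r (T \<phi>) - z *\<^sub>C calc r \<phi> = \<phi>"
    and resolvent_right: "T (calc r \<phi>) - z *\<^sub>C calc r \<phi> = \<phi>"
proof -
  have r: "bdd_borel r" unfolding r_def by (rule bdd_borel_resolvent[OF z])
  have *: "calc (\<lambda>x. cut of_real x * r x + (- z) * r x) \<phi> = \<phi>"
  proof -
    have "calc (\<lambda>x. cut of_real x * r x + (- z) * r x) \<phi> = calc (\<lambda>_. 1) \<phi>"
    proof (rule calc_cong_supp)
      have "bdd_borel (\<lambda>x. cut of_real x * r x + (- z) * r x)"
        by (intro bdd_borel_add bdd_borel_mult bdd_borel_const r bdd_borel_cut_id)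
      then show "(\<lambda>x. cut of_real x * r x + (- z) * r x) \<in> borel_measurable borel"
        by (simp add: bdd_borel_def)
      show "cut of_real x * r x + (- z) * r x = 1" if "x \<in> supp" for x
      proof -
        have "cut of_real x * r x + (- z) * r x = (of_real x - z) * r x"
          using that by (simp add: cut_simp algebra_simps)
        then show ?thesis using resolvent_nonzero[OF z, of x] by (simp add: r_def)
      qed
    qed simp
    then show ?thesis by (simp only: calc_one)
  qed
  have "calc (\<lambda>x. cut of_real x * r x + (- z) * r x) \<phi>
      = calc (\<lambda>x. cut of_real x * r x) \<phi> + (- z) *\<^sub>C calc r \<phi>"
    by (simp only: calc_add bdd_borel_mult bdd_borel_const r bdd_borel_cut_id calc_scale)
  then have **: "calc (\<lambda>x. cut of_real x * r x) \<phi> - z *\<^sub>C calc r \<phi> = \<phi>"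
    unfolding * by (simp add: diff_conv_add_uminus uminus_scaleC del: add_uminus_conv_diff)
  show "calc r (T \<phi>) - z *\<^sub>C calc r \<phi> = \<phi>"
    using ** by (simp add: calc_mult[OF r bdd_borel_cut_id] T_eq_calc)
  have "calc (\<lambda>x. cut of_real x * r x) \<phi> = calc (\<lambda>x. r x * cut of_real x) \<phi>"
    by (simp only: mult.commute)
  also have "\<dots> = T (calc r \<phi>)"
    by (simp add: calc_mult[OF bdd_borel_cut_id r] T_eq_calc)
  finally show "T (calc r \<phi>) - z *\<^sub>C calc r \<phi> = \<phi>" using ** by simp
qed

end


section \<open>Functions of two operators that are close on a spectral subspace\<close>

text \<open>Two operators that differ little on the range of a spectral projection of the first one. This range is
  invariant under functions of \<open>T\<close> but in general not under functions of \<open>T'\<close>. The estimates below are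
  therefore arranged so that \<open>T' - T\<close> acts before any function of \<open>T'\<close> and after functions of \<open>T\<close> only.\<close>

locale spectral_perturbation = H: spectral_pair T P + H': spectral_pair T' P'
  for T :: "ell2 \<Rightarrow> ell2" and P and T' :: "ell2 \<Rightarrow> ell2" and P' +
  fixes A :: "real set" and R \<kappa> :: real
  assumes A: "A \<in> sets borel" and \<kappa>: "\<kappa> \<ge> 0" and R: "R \<ge> 0"
    and T_bound: "\<And>\<eta>. norm (T \<eta>) \<le> R * norm \<eta>"
    and T'_bound: "\<And>\<eta>. norm (T' \<eta>) \<le> R * norm \<eta>"
    and close: "\<And>\<eta>. P A \<eta> = \<eta> \<Longrightarrow> norm (T' \<eta> - T \<eta>) \<le> \<kappa> * norm \<eta>"
begin

lemma norm_power_le: "norm ((T ^^ n) \<phi>) \<le> R ^ n * norm \<phi>"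
proof (induction n)
  case (Suc n)
  have "norm (T ((T ^^ n) \<phi>)) \<le> R * norm ((T ^^ n) \<phi>)" by (rule T_bound)
  also have "\<dots> \<le> R * (R ^ n * norm \<phi>)" by (rule mult_left_mono[OF Suc R])
  finally show ?case by (simp add: mult.assoc)
qed simp

text \<open>Telescoping: \<open>T'\<^sup>n\<^sup>+\<^sup>1 \<phi> - T\<^sup>n\<^sup>+\<^sup>1 \<phi> = T' (T'\<^sup>n \<phi> - T\<^sup>n \<phi>) + (T' - T) T\<^sup>n \<phi>\<close>. The natural factor
  \<open>n R\<^sup>n\<^sup>-\<^sup>1\<close> is replaced by the larger \<open>(1 + R)\<^sup>n\<close>, which sums to an exponential.\<close>

lemma power_difference:
  assumes \<phi>: "P A \<phi> = \<phi>"
  shows "norm ((T' ^^ n) \<phi> - (T ^^ n) \<phi>) \<le> (1 + R) ^ n * \<kappa> * norm \<phi>"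
proof (induction n)
  case 0
  then show ?case using \<kappa> by simp
next
  case (Suc n)
  define \<eta> where "\<eta> = (T ^^ n) \<phi>"
  have \<eta>: "P A \<eta> = \<eta>" using \<phi> by (simp add: \<eta>_def H.P_T_power A)
  have "(T' ^^ Suc n) \<phi> - (T ^^ Suc n) \<phi> = T' ((T' ^^ n) \<phi> - \<eta>) + (T' \<eta> - T \<eta>)"
    by (simp add: H'.T_diff \<eta>_def)
  also have "norm \<dots> \<le> R * norm ((T' ^^ n) \<phi> - \<eta>) + \<kappa> * norm \<eta>"
    by (intro norm_triangle_le add_mono T'_bound close \<eta>)
  also have "\<dots> \<le> R * ((1 + R) ^ n * \<kappa> * norm \<phi>) + \<kappa> * ((1 + R) ^ n * norm \<phi>)"
  proof (intro add_mono mult_left_mono \<kappa> R)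
    show "norm ((T' ^^ n) \<phi> - \<eta>) \<le> (1 + R) ^ n * \<kappa> * norm \<phi>"
      using Suc by (simp add: \<eta>_def)
    have "norm \<eta> \<le> R ^ n * norm \<phi>" unfolding \<eta>_def by (rule norm_power_le)
    also have "\<dots> \<le> (1 + R) ^ n * norm \<phi>"
      using R by (intro mult_right_mono power_mono) auto
    finally show "norm \<eta> \<le> (1 + R) ^ n * norm \<phi>" .
  qed
  also have "\<dots> = (1 + R) ^ Suc n * \<kappa> * norm \<phi>" by (simp add: algebra_simps)
  finally show ?case .
qed

lemma monomial_difference:
  assumes "P A \<phi> = \<phi>"
  shows "norm (H'.calc (\<lambda>x. of_real x ^ n) \<phi> - H.calc (\<lambda>x. of_real x ^ n) \<phi>) \<le> (1 + R) ^ n * \<kappa> * norm \<phi>"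
  unfolding H.calc_monomial H'.calc_monomial by (rule power_difference[OF assms])

lemma exp_difference:
  fixes t :: real
  assumes \<phi>: "P A \<phi> = \<phi>"
  defines "F \<equiv> \<lambda>x. exp (\<i> * complex_of_real t * of_real x)"
  shows "norm (H'.calc F \<phi> - H.calc F \<phi>) \<le> exp (\<bar>t\<bar> * (1 + R)) * \<kappa> * norm \<phi>"
proof (rule Lim_bounded)
  show "(\<lambda>N. norm ((\<Sum>n<N. ((\<i> * of_real t) ^ n / fact n) *\<^sub>C (T' ^^ n) \<phi>)
      - (\<Sum>n<N. ((\<i> * of_real t) ^ n / fact n) *\<^sub>C (T ^^ n) \<phi>))) \<longlonglongrightarrow> norm (H'.calc F \<phi> - H.calc F \<phi>)"
    unfolding F_def by (intro tendsto_intros H.calc_exp_tendsto H'.calc_exp_tendsto)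
  have "norm ((\<Sum>n<N. ((\<i> * of_real t) ^ n / fact n) *\<^sub>C (T' ^^ n) \<phi>)
      - (\<Sum>n<N. ((\<i> * of_real t) ^ n / fact n) *\<^sub>C (T ^^ n) \<phi>)) \<le> exp (\<bar>t\<bar> * (1 + R)) * \<kappa> * norm \<phi>" for N
  proof -
    have "norm ((\<Sum>n<N. ((\<i> * of_real t) ^ n / fact n) *\<^sub>C (T' ^^ n) \<phi>)
        - (\<Sum>n<N. ((\<i> * of_real t) ^ n / fact n) *\<^sub>C (T ^^ n) \<phi>))
        = norm (\<Sum>n<N. ((\<i> * of_real t) ^ n / fact n) *\<^sub>C ((T' ^^ n) \<phi> - (T ^^ n) \<phi>))"
      by (simp only: sum_subtractf scaleC_diff_right)
    also have "\<dots> \<le> (\<Sum>n<N. ((\<bar>t\<bar> * (1 + R)) ^ n /\<^sub>R fact n) * (\<kappa> * norm \<phi>))"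
    proof (rule sum_norm_le)
      fix n
      have "norm (((\<i> * of_real t) ^ n / fact n) *\<^sub>C ((T' ^^ n) \<phi> - (T ^^ n) \<phi>))
          = (\<bar>t\<bar> ^ n / fact n) * norm ((T' ^^ n) \<phi> - (T ^^ n) \<phi>)"
        by (simp add: norm_scaleC norm_divide norm_power norm_mult)
      also have "\<dots> \<le> (\<bar>t\<bar> ^ n / fact n) * ((1 + R) ^ n * \<kappa> * norm \<phi>)"
        by (intro mult_left_mono power_difference \<phi>) simp
      finally show "norm (((\<i> * of_real t) ^ n / fact n) *\<^sub>C ((T' ^^ n) \<phi> - (T ^^ n) \<phi>))
          \<le> ((\<bar>t\<bar> * (1 + R)) ^ n /\<^sub>R fact n) * (\<kappa> * norm \<phi>)"
        by (simp add: power_mult_distrib divide_inverse mult_ac)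
    qed
    also have "\<dots> = (\<Sum>n<N. (\<bar>t\<bar> * (1 + R)) ^ n /\<^sub>R fact n) * (\<kappa> * norm \<phi>)"
      by (rule sum_distrib_right[symmetric])
    also have "\<dots> \<le> exp (\<bar>t\<bar> * (1 + R)) * (\<kappa> * norm \<phi>)"
      unfolding exp_def using \<kappa> R
      by (intro mult_right_mono sum_le_suminf summable_exp_generic) auto
    finally show ?thesis by (simp add: mult.assoc)
  qed
  then show "\<forall>n\<ge>0. norm ((\<Sum>n<n. ((\<i> * of_real t) ^ n / fact n) *\<^sub>C (T' ^^ n) \<phi>)
      - (\<Sum>n<n. ((\<i> * of_real t) ^ n / fact n) *\<^sub>C (T ^^ n) \<phi>)) \<le> exp (\<bar>t\<bar> * (1 + R)) * \<kappa> * norm \<phi>"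
    by blast
qed

text \<open>This is the second resolvent identity
  \<open>(T' - z)\<^sup>-\<^sup>1 \<phi> - (T - z)\<^sup>-\<^sup>1 \<phi> = - (T' - z)\<^sup>-\<^sup>1 (T' - T) (T - z)\<^sup>-\<^sup>1 \<phi>\<close>;
  the inner resolvent keeps \<open>\<phi>\<close> in the range of \<open>P A\<close>.\<close>

lemma resolvent_difference:
  assumes \<phi>: "P A \<phi> = \<phi>" and z: "Im z > 0"
  defines "r \<equiv> \<lambda>x. inverse (complex_of_real x - z)"
  shows "norm (H'.calc r \<phi> - H.calc r \<phi>) \<le> (4 / Im z)\<^sup>2 * \<kappa> * norm \<phi>"
proof -
  have r: "bdd_borel r" "\<And>x. cmod (r x) \<le> 1 / Im z"
    unfolding r_def using bdd_borel_resolvent[OF z] norm_resolvent[OF z] by auto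
  define \<eta> where "\<eta> = H.calc r \<phi>"
  have \<eta>: "P A \<eta> = \<eta>" by (simp add: \<eta>_def H.P_calc A r \<phi>)
  have "\<phi> = T \<eta> - z *\<^sub>C \<eta>"
    unfolding \<eta>_def r_def by (rule H.resolvent_right[OF z, symmetric])
  then have e1: "H'.calc r \<phi> = H'.calc r (T \<eta>) - z *\<^sub>C H'.calc r \<eta>"
    by (simp add: H'.calc_diff_right H'.calc_scale_right r)
  have e2: "\<eta> = H'.calc r (T' \<eta>) - z *\<^sub>C H'.calc r \<eta>"
    unfolding r_def by (rule H'.resolvent_left[OF z, symmetric])
  have "x - y = u - v" if "x = u - w" "y = v - w" for x y u v w :: ell2
    using that by simp
  from this[OF e1 e2] have "H'.calc r \<phi> - \<eta> = H'.calc r (T \<eta> - T' \<eta>)"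
    by (simp only: H'.calc_diff_right r)
  then have "norm (H'.calc r \<phi> - \<eta>) \<le> 4 * (1 / Im z) * norm (T \<eta> - T' \<eta>)"
    using H'.norm_calc_le[OF r] by simp
  also have "\<dots> \<le> 4 * (1 / Im z) * (\<kappa> * norm \<eta>)"
    using z close[OF \<eta>] by (intro mult_left_mono) (auto simp: norm_minus_commute)
  also have "\<dots> \<le> 4 * (1 / Im z) * (\<kappa> * (4 * (1 / Im z) * norm \<phi>))"
    using z \<kappa> H.norm_calc_le[OF r, of \<phi>] by (intro mult_left_mono) (auto simp: \<eta>_def)
  finally show ?thesis by (simp add: \<eta>_def power2_eq_square mult_ac)
qed

end

text \<open>The constant depends on the norm bound \<open>R\<close> and on \<open>F\<close> alone. In particular one constant serves
  all pairs \<open>J\<close>, \<open>J\<^sub>\<theta>\<close> at once.\<close>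

theorem test_fun_difference:
  assumes F: "F \<in> test_funs" and R: "R \<ge> 0"
  shows "\<exists>\<gamma>\<ge>0. \<forall>T P T' P' A \<kappa> \<phi>. spectral_perturbation T P T' P' A R \<kappa> \<longrightarrow> P A \<phi> = \<phi> \<longrightarrow>
    norm (functional_calculus P' F \<phi> - functional_calculus P F \<phi>) \<le> \<gamma> * \<kappa> * norm \<phi>"
proof -
  let ?gens = "monomial_funs \<union> exponential_funs \<union> resolvent_funs"
  let ?good = "\<lambda>g \<gamma>. \<gamma> \<ge> 0 \<and> (\<forall>T P T' P' A \<kappa> \<phi>. spectral_perturbation T P T' P' A R \<kappa> \<longrightarrow> P A \<phi> = \<phi> \<longrightarrow>
    norm (functional_calculus P' g \<phi> - functional_calculus P g \<phi>) \<le> \<gamma> * \<kappa> * norm \<phi>)"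
  obtain G c where G: "finite G" "G \<subseteq> ?gens" and F_eq: "F = (\<lambda>x. \<Sum>g\<in>G. c g * g x)"
    using F unfolding test_funs_def by blast
  have cont: "continuous_on UNIV g" if "g \<in> ?gens" for g
    using that continuous_resolvent
    by (auto simp: monomial_funs_def exponential_funs_def resolvent_funs_def intro!: continuous_intros)
  have "\<exists>\<gamma>. ?good g \<gamma>" if g: "g \<in> ?gens" for g
  proof -
    consider n where "g = (\<lambda>x. of_real x ^ n)" | t where "g = (\<lambda>x. exp (\<i> * complex_of_real t * of_real x))"
      | z where "Im z > 0" "g = (\<lambda>x. inverse (complex_of_real x - z))"
      using g by (elim UnE) (auto simp: monomial_funs_def exponential_funs_def resolvent_funs_def)
    then show ?thesis
    proof cases
      case (1 n)
      then show ?thesis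
        using R by (intro exI[of _ "(1 + R) ^ n"]) (auto intro: spectral_perturbation.monomial_difference)
    next
      case (2 t)
      then show ?thesis
        by (intro exI[of _ "exp (\<bar>t\<bar> * (1 + R))"]) (auto intro: spectral_perturbation.exp_difference)
    next
      case (3 z)
      then show ?thesis
        by (intro exI[of _ "(4 / Im z)\<^sup>2"]) (auto intro: spectral_perturbation.resolvent_difference)
    qed
  qed
  then obtain \<gamma> where \<gamma>: "\<And>g. g \<in> ?gens \<Longrightarrow> ?good g (\<gamma> g)" by metis
  show ?thesis
  proof (intro exI[of _ "\<Sum>g\<in>G. cmod (c g) * \<gamma> g"] conjI allI impI)
    show "0 \<le> (\<Sum>g\<in>G. cmod (c g) * \<gamma> g)"
      using \<gamma> G(2) by (intro sum_nonneg mult_nonneg_nonneg) auto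
    fix T P T' P' A \<kappa> \<phi>
    assume sp: "spectral_perturbation T P T' P' A R \<kappa>" and \<phi>: "P A \<phi> = \<phi>"
    interpret spectral_perturbation T P T' P' A R \<kappa> by (rule sp)
    have "H'.calc F \<phi> - H.calc F \<phi> = (\<Sum>g\<in>G. c g *\<^sub>C (H'.calc g \<phi> - H.calc g \<phi>))"
      unfolding F_eq using cont G(2)
      by (subst H.calc_sum H'.calc_sum, blast)+ (simp add: sum_subtractf scaleC_diff_right)
    also have "norm \<dots> \<le> (\<Sum>g\<in>G. cmod (c g) * \<gamma> g * (\<kappa> * norm \<phi>))"
    proof (rule sum_norm_le)
      fix g assume "g \<in> G"
      then have "norm (H'.calc g \<phi> - H.calc g \<phi>) \<le> \<gamma> g * \<kappa> * norm \<phi>"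
        using \<gamma>[of g] G(2) sp \<phi> by blast
      from mult_left_mono[OF this norm_ge_zero[of "c g"]]
      show "norm (c g *\<^sub>C (H'.calc g \<phi> - H.calc g \<phi>)) \<le> cmod (c g) * \<gamma> g * (\<kappa> * norm \<phi>)"
        by (simp add: norm_scaleC mult.assoc)
    qed
    also have "\<dots> = (\<Sum>g\<in>G. cmod (c g) * \<gamma> g) * \<kappa> * norm \<phi>"
      by (simp add: sum_distrib_right mult.assoc)
    finally show "norm (H'.calc F \<phi> - H.calc F \<phi>) \<le> (\<Sum>g\<in>G. cmod (c g) * \<gamma> g) * \<kappa> * norm \<phi>" .
  qed
qed


section \<open>Comparison of measures on the line by their values on intervals\<close>

text \<open>In a subcover of minimal cardinality no point lies in three intervals: of three intervals through a
  point, the one reaching farthest to the left and the one reaching farthest to the right cover the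
  third.\<close>

lemma finite_interval_cover_overlap:
  fixes l r :: "'a \<Rightarrow> real"
  assumes "finite I" and "K \<subseteq> (\<Union>i\<in>I. {l i<..<r i})"
  obtains J where "J \<subseteq> I" "K \<subseteq> (\<Union>i\<in>J. {l i<..<r i})" "\<And>x. card {i \<in> J. x \<in> {l i<..<r i}} \<le> 2"
proof -
  let ?cov = "\<lambda>J. J \<subseteq> I \<and> K \<subseteq> (\<Union>i\<in>J. {l i<..<r i})"
  have "?cov I" using assms(2) by simp
  then obtain J where J: "?cov J" and min: "\<And>J'. ?cov J' \<Longrightarrow> card J \<le> card J'"
    using ex_has_least_nat[of ?cov I card] by blast
  have fin: "finite J" using J assms(1) finite_subset by blast
  have "card {i \<in> J. x \<in> {l i<..<r i}} \<le> 2" for x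
  proof (rule ccontr)
    define C where "C = {i \<in> J. x \<in> {l i<..<r i}}"
    assume "\<not> card {i \<in> J. x \<in> {l i<..<r i}} \<le> 2"
    then have C: "card C > 2" by (simp add: C_def)
    have fC: "finite C" using fin by (simp add: C_def)
    have nC: "C \<noteq> {}" using C by auto
    obtain i0 where i0: "i0 \<in> C" "\<And>i. i \<in> C \<Longrightarrow> l i0 \<le> l i"
      using Min_in[of "l ` C"] Min_le[of "l ` C"] fC nC
      by (metis (no_types, lifting) finite_imageI image_iff image_is_empty)
    obtain i1 where i1: "i1 \<in> C" "\<And>i. i \<in> C \<Longrightarrow> r i \<le> r i1"
      using Max_in[of "r ` C"] Max_ge[of "r ` C"] fC nC
      by (metis (no_types, lifting) finite_imageI image_iff image_is_empty)
    have "\<not> C \<subseteq> {i0, i1}"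
    proof
      assume "C \<subseteq> {i0, i1}"
      then have "card C \<le> card {i0, i1}" by (rule card_mono[rotated]) simp
      also have "\<dots> \<le> 2" by (simp add: card_insert_if)
      finally show False using C by simp
    qed
    then obtain k where k: "k \<in> C" "k \<noteq> i0" "k \<noteq> i1" by blast
    have "{l k<..<r k} \<subseteq> {l i0<..<r i0} \<union> {l i1<..<r i1}"
    proof
      fix y assume y: "y \<in> {l k<..<r k}"
      show "y \<in> {l i0<..<r i0} \<union> {l i1<..<r i1}"
      proof (cases "y \<le> x")
        case True
        then show ?thesis using y i0(2)[OF k(1)] i0(1) by (auto simp: C_def)
      next
        case False
        then show ?thesis using y i1(2)[OF k(1)] i1(1) by (auto simp: C_def)
      qed
    qed
    moreover have "i0 \<in> J - {k}" "i1 \<in> J - {k}" "K \<subseteq> (\<Union>i\<in>J. {l i<..<r i})"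
      using J i0(1) i1(1) k by (auto simp: C_def)
    ultimately have "K \<subseteq> (\<Union>i\<in>J - {k}. {l i<..<r i})" by blast
    then have "?cov (J - {k})" using J by blast
    then have "card J \<le> card (J - {k})" by (rule min)
    moreover have "card (J - {k}) < card J"
      using k(1) fin by (intro card_Diff1_less) (auto simp: C_def)
    ultimately show False by simp
  qed
  then show thesis using that[of J] J by blast
qed

text \<open>A one-sided differentiation theorem for arbitrary finite measures, with a factor 2 from the overlap of
  the covering intervals. Regularity supplies a compact set inside \<open>A\<close> that almost exhausts \<open>\<nu>\<close> and
  an open set around \<open>A\<close> that \<open>\<mu>\<close> hardly distinguishes from \<open>A\<close>.\<close>

lemma measure_le_by_interval_differentiation:
  fixes \<mu> \<nu> :: "real measure"
  assumes "finite_measure \<mu>" "finite_measure \<nu>"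
    and sets: "sets \<mu> = sets borel" "sets \<nu> = sets borel"
    and A: "A \<in> sets borel" and c: "c \<ge> 0"
    and dens: "\<And>x d. x \<in> A \<Longrightarrow> d > 0 \<Longrightarrow>
      \<exists>e. 0 < e \<and> e < d \<and> measure \<nu> {x - e<..<x + e} \<le> c * measure \<mu> {x - e<..<x + e}"
  shows "measure \<nu> A \<le> 2 * c * measure \<mu> A"
proof -
  interpret \<mu>: finite_measure \<mu> by fact
  interpret \<nu>: finite_measure \<nu> by fact
  note [measurable_cong] = sets
  have approx: "measure \<nu> A \<le> 2 * c * (measure \<mu> A + e) + e" if e: "e > 0" for e
  proof -
    have "\<exists>K. K \<subseteq> A \<and> compact K \<and> measure \<nu> A < measure \<nu> K + e"
    proof (rule ccontr)
      assume "\<not> ?thesis"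
      then have *: "measure \<nu> K \<le> measure \<nu> A - e" if "K \<subseteq> A" "compact K" for K
        using that by fastforce
      have "0 \<le> measure \<nu> A - e" using *[of "{}"] by simp
      have "emeasure \<nu> A = (SUP K\<in>{K. K \<subseteq> A \<and> compact K}. emeasure \<nu> K)"
        by (rule inner_regular) (simp_all add: sets A)
      also have "\<dots> \<le> ennreal (measure \<nu> A - e)"
        using * by (intro SUP_least) (auto simp: \<nu>.emeasure_eq_measure intro!: ennreal_leI)
      finally show False
        using e \<open>0 \<le> measure \<nu> A - e\<close> by (simp add: \<nu>.emeasure_eq_measure ennreal_le_iff)
    qed
    then obtain K where K: "K \<subseteq> A" "compact K" "measure \<nu> A < measure \<nu> K + e" by blast
    have "\<exists>U. A \<subseteq> U \<and> open U \<and> measure \<mu> U < measure \<mu> A + e"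
    proof (rule ccontr)
      assume "\<not> ?thesis"
      then have *: "measure \<mu> A + e \<le> measure \<mu> U" if "A \<subseteq> U" "open U" for U
        using that by fastforce
      have "ennreal (measure \<mu> A + e) \<le> (INF U\<in>{U. A \<subseteq> U \<and> open U}. emeasure \<mu> U)"
        using * by (intro INF_greatest) (auto simp: \<mu>.emeasure_eq_measure intro!: ennreal_leI)
      also have "\<dots> = emeasure \<mu> A"
        by (rule outer_regular[symmetric]) (simp_all add: sets A)
      finally show False
        using e by (simp add: \<mu>.emeasure_eq_measure ennreal_le_iff)
    qed
    then obtain U where U: "A \<subseteq> U" "open U" "measure \<mu> U < measure \<mu> A + e" by blast
    have "\<exists>d>0. {x - d<..<x + d} \<subseteq> U \<and> measure \<nu> {x - d<..<x + d} \<le> c * measure \<mu> {x - d<..<x + d}"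
      if x: "x \<in> A" for x
    proof -
      obtain d0 where d0: "d0 > 0" "ball x d0 \<subseteq> U"
        using U(1,2) x open_contains_ball by blast
      obtain d where "0 < d" "d < d0" "measure \<nu> {x - d<..<x + d} \<le> c * measure \<mu> {x - d<..<x + d}"
        using dens[OF x d0(1)] by blast
      moreover from this have "{x - d<..<x + d} \<subseteq> ball x d0" by (auto simp: dist_real_def)
      ultimately show ?thesis using d0(2) by blast
    qed
    then obtain d where d: "\<And>x. x \<in> A \<Longrightarrow> d x > 0" "\<And>x. x \<in> A \<Longrightarrow> {x - d x<..<x + d x} \<subseteq> U"
      "\<And>x. x \<in> A \<Longrightarrow> measure \<nu> {x - d x<..<x + d x} \<le> c * measure \<mu> {x - d x<..<x + d x}"
      by metis
    let ?I = "\<lambda>x. {x - d x<..<x + d x}"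
    have "K \<subseteq> (\<Union>x\<in>K. ?I x)" using d(1) K(1) by fastforce
    with K(2) obtain C where C: "C \<subseteq> K" "finite C" "K \<subseteq> (\<Union>x\<in>C. ?I x)"
      using compactE_image[of K K ?I] by (metis open_greaterThanLessThan)
    obtain J where J: "J \<subseteq> C" "K \<subseteq> (\<Union>x\<in>J. ?I x)" "\<And>y. card {x \<in> J. y \<in> ?I x} \<le> 2"
      using finite_interval_cover_overlap[OF C(2,3)] by blast
    have fJ: "finite J" and JA: "J \<subseteq> A" using J(1) C K(1) finite_subset by blast+
    have "measure \<nu> K \<le> measure \<nu> (\<Union>x\<in>J. ?I x)"
      using J(2) fJ by (intro \<nu>.finite_measure_mono) (auto simp: sets)
    also have "\<dots> \<le> (\<Sum>x\<in>J. measure \<nu> (?I x))"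
      by (rule \<nu>.finite_measure_subadditive_finite) (auto simp: fJ sets)
    also have "\<dots> \<le> (\<Sum>x\<in>J. c * measure \<mu> (?I x))"
      using d(3) JA by (intro sum_mono) auto
    also have "\<dots> = c * (\<Sum>x\<in>J. measure \<mu> (?I x))" by (simp add: sum_distrib_left)
    also have "\<dots> \<le> c * (2 * measure \<mu> U)"
    proof (rule mult_left_mono[OF _ c])
      have int: "integrable \<mu> (indicat_real B)" if "B \<in> sets borel" for B
        by (rule integrable_real_indicator) (use that in \<open>auto simp: sets \<mu>.emeasure_eq_measure\<close>)
      have sp: "space \<mu> = UNIV" using sets_eq_imp_space_eq[OF sets(1)] by simp
      have "(\<Sum>x\<in>J. measure \<mu> (?I x)) = (\<Sum>x\<in>J. \<integral>y. indicat_real (?I x) y \<partial>\<mu>)"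
        by (simp add: sp)
      also have "\<dots> = (\<integral>y. (\<Sum>x\<in>J. indicat_real (?I x) y) \<partial>\<mu>)"
        by (rule Bochner_Integration.integral_sum[symmetric], rule int) simp
      also have "\<dots> \<le> (\<integral>y. 2 * indicat_real U y \<partial>\<mu>)"
      proof (rule integral_mono)
        show "integrable \<mu> (\<lambda>y. \<Sum>x\<in>J. indicat_real (?I x) y)"
          by (intro Bochner_Integration.integrable_sum int) simp
        show "integrable \<mu> (\<lambda>y. 2 * indicat_real U y)"
          using U(2) by (intro integrable_mult_right int) simp
        fix y
        have "(\<Sum>x\<in>J. indicat_real (?I x) y) = real (card {x \<in> J. y \<in> ?I x})"
          using fJ by (simp add: indicator_def sum.If_cases Int_def)
        also have "\<dots> \<le> 2 * indicat_real U y"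
        proof (cases "y \<in> U")
          case True
          then show ?thesis using J(3)[of y] by simp
        next
          case False
          then have "{x \<in> J. y \<in> ?I x} = {}" using d(2) JA by blast
          then have "card {x \<in> J. y \<in> ?I x} = 0" by (simp only: card.empty)
          then show ?thesis by simp
        qed
        finally show "(\<Sum>x\<in>J. indicat_real (?I x) y) \<le> 2 * indicat_real U y" .
      qed
      also have "\<dots> = 2 * measure \<mu> U" by (simp add: sp)
      finally show "(\<Sum>x\<in>J. measure \<mu> (?I x)) \<le> 2 * measure \<mu> U" .
    qed
    also have "\<dots> \<le> c * (2 * (measure \<mu> A + e))"
      using U(3) c by (intro mult_left_mono) auto
    finally show ?thesis using K(3) by (simp add: algebra_simps)
  qed
  have "((\<lambda>e. 2 * c * (measure \<mu> A + e) + e) \<longlongrightarrow> 2 * c * (measure \<mu> A + 0) + 0) (at_right 0)"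
    by (intro tendsto_intros)
  then have "measure \<nu> A \<le> 2 * c * (measure \<mu> A + 0) + 0"
    by (rule tendsto_lowerbound)
       (rule eventually_mono[OF eventually_at_right_less approx], simp_all)
  then show ?thesis by simp
qed

text \<open>The measure of a moving interval is a difference of two monotone functions of its centre.\<close>

lemma borel_measurable_measure_interval:
  fixes M :: "real measure"
  assumes "finite_measure M" and sets: "sets M = sets borel"
  shows "(\<lambda>x. measure M {x - e<..<x + e}) \<in> borel_measurable borel"
proof (cases "e > 0")
  case True
  interpret finite_measure M by fact
  have eq: "measure M {x - e<..<x + e} = measure M {..<x + e} - measure M {..x - e}" for x
  proof -
    have *: "{x - e<..<x + e} = {..<x + e} - {..x - e}" using True by auto
    show ?thesis
      unfolding * by (rule finite_measure_Diff) (use True in \<open>auto simp: sets\<close>)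
  qed
  have "mono (\<lambda>x. measure M {..<x + e})" "mono (\<lambda>x. measure M {..x - e})"
    by (auto intro!: monoI finite_measure_mono simp: sets)
  then show ?thesis
    unfolding eq by (intro borel_measurable_diff borel_measurable_mono)
qed simp


section \<open>Subordinate solutions and boundary angles\<close>

text \<open>The three-term recursion determines a solution from two neighbouring values because \<open>a\<close> has no zeros.\<close>

lemma solution_zeroI:
  assumes a: "\<And>n. a n > 0" and u: "is_solution a b E u" and init: "u 1 = 0" "u 2 = 0"
  shows "u n = 0"
proof -
  have eq: "of_real (a (n - 1)) * u (n - 1) + of_real (a n) * u (n + 1) + of_real (b n) * u n = of_real E * u n" for n
    using u by (simp add: is_solution_def jacobi_expr_def)
  have nz: "complex_of_real (a n) \<noteq> 0" for n using a[of n] by simp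
  have "u n = 0 \<and> u (n + 1) = 0"
  proof (induction n rule: int_induct[where k = 1])
    case base
    then show ?case using init by simp
  next
    case (step1 i)
    then show ?case using eq[of "i + 1"] nz[of "i + 1"] by (simp add: add.assoc)
  next
    case (step2 i)
    then show ?case using eq[of i] nz[of "i - 1"] by simp
  qed
  then show ?thesis by simp
qed

lemma right_norm_pos:
  assumes a: "\<And>n. a n > 0" and u: "is_solution a b E u" and nz: "u n \<noteq> 0" and L: "L \<ge> 2"
  shows "right_norm L u > 0"
proof -
  have "u 1 \<noteq> 0 \<or> u 2 \<noteq> 0" using solution_zeroI[OF a u] nz by blast
  then have "0 < (cmod (u 1))\<^sup>2 + (cmod (u 2))\<^sup>2" by (auto intro: add_pos_nonneg add_nonneg_pos)
  also have "\<dots> = (\<Sum>n\<in>{1, 2}. (cmod (u n))\<^sup>2)" by simp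
  also have "\<dots> \<le> (\<Sum>n = 1..\<lfloor>L\<rfloor>. (cmod (u n))\<^sup>2)"
    using L by (intro sum_mono2) (auto simp: le_floor_iff)
  also have "\<dots> \<le> (\<Sum>n = 1..\<lfloor>L\<rfloor>. (cmod (u n))\<^sup>2) + (L - of_int \<lfloor>L\<rfloor>) * (cmod (u (\<lfloor>L\<rfloor> + 1)))\<^sup>2"
    by simp
  finally show ?thesis by (simp add: right_norm_def)
qed

text \<open>Two linearly independent subordinate solutions would each be negligible against the other.\<close>

lemma subordinate_unique:
  assumes a: "\<And>n. a n > 0" and u: "subordinate a b E u" and v: "subordinate a b E v"
  obtains c where "c \<noteq> 0" "\<And>n. v n = c * u n"
proof -
  obtain m n where mn: "u m \<noteq> 0" "v n \<noteq> 0" using u v by (auto simp: subordinate_def)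
  have sol: "is_solution a b E u" "is_solution a b E v" using u v by (auto simp: subordinate_def)
  have "\<not> lin_indep_fun u v"
  proof
    assume ind: "lin_indep_fun u v"
    then have ind': "lin_indep_fun v u"
      unfolding lin_indep_fun_def by (metis add.commute)
    have "((\<lambda>L. right_norm L u / right_norm L v) \<longlongrightarrow> 0) at_top"
      "((\<lambda>L. right_norm L v / right_norm L u) \<longlongrightarrow> 0) at_top"
      using u v sol ind ind' unfolding subordinate_def by blast+
    then have "\<forall>\<^sub>F L in at_top. right_norm L u / right_norm L v < 1"
      "\<forall>\<^sub>F L in at_top. right_norm L v / right_norm L u < 1"
      by (auto dest: order_tendstoD(2)[where a = 1])
    moreover have "\<forall>\<^sub>F L in at_top. (2::real) \<le> L" by (rule eventually_ge_at_top)
    ultimately have "\<forall>\<^sub>F L :: real in at_top. False"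
    proof eventually_elim
      case (elim L)
      have "right_norm L u > 0" "right_norm L v > 0"
        using right_norm_pos[OF a sol(1) mn(1)] right_norm_pos[OF a sol(2) mn(2)] elim(3) by auto
      with elim(1,2) show False by (simp add: divide_less_eq)
    qed
    then show False by simp
  qed
  then obtain c d where cd: "\<And>n. c * u n + d * v n = 0" "c \<noteq> 0 \<or> d \<noteq> 0"
    unfolding lin_indep_fun_def by blast
  have "d \<noteq> 0" using cd(1)[of m] cd(2) mn(1) by auto
  have "c \<noteq> 0" using cd(1)[of n] cd(2) mn(2) by auto
  have "v n = (- c / d) * u n" for n
    using cd(1)[of n] \<open>d \<noteq> 0\<close> by (simp add: field_simps eq_neg_iff_add_eq_0 add.commute)
  with \<open>c \<noteq> 0\<close> \<open>d \<noteq> 0\<close> show thesis by (intro that[of "- c / d"]) auto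
qed

text \<open>By uniqueness, the boundary condition may be read off from any one subordinate solution.\<close>

lemma sub_set_theta_iff:
  fixes u :: "int \<Rightarrow> real"
  assumes a: "\<And>n. a n > 0" and u: "subordinate a b E (\<lambda>n. of_real (u n))"
  shows "E \<in> sub_set_theta a b \<theta> \<longleftrightarrow> u 0 * cos \<theta> + u 1 * sin \<theta> = 0"
proof
  assume "E \<in> sub_set_theta a b \<theta>"
  then obtain v where v: "subordinate a b E v" "v 0 * of_real (cos \<theta>) + v 1 * of_real (sin \<theta>) = 0"
    by (auto simp: sub_set_theta_def)
  obtain c where c: "c \<noteq> 0" "\<And>n. v n = c * of_real (u n)"
    using subordinate_unique[OF a u v(1)] by blast
  have "c * of_real (u 0 * cos \<theta> + u 1 * sin \<theta>) = 0"
    using v(2) by (simp add: c(2) algebra_simps)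
  then show "u 0 * cos \<theta> + u 1 * sin \<theta> = 0"
    using c(1) by (simp only: mult_eq_0_iff of_real_eq_0_iff) simp
next
  assume "u 0 * cos \<theta> + u 1 * sin \<theta> = 0"
  then have "of_real (u 0) * of_real (cos \<theta>) + of_real (u 1) * of_real (sin \<theta>) = (0 :: complex)"
    by (simp only: of_real_0 flip: of_real_mult of_real_add)
  then show "E \<in> sub_set_theta a b \<theta>"
    unfolding sub_set_theta_def using u by blast
qed

text \<open>The boundary condition at angle \<open>t\<close> forces \<open>(p, q) = \<plusminus>(sin t, - cos t)\<close>.\<close>

lemma unit_vector_angle:
  fixes p q t :: real
  assumes unit: "p\<^sup>2 + q\<^sup>2 = 1" and bc: "p * cos t + q * sin t = 0"
  shows "p\<^sup>2 = (sin t)\<^sup>2" "p * q = - (sin t * cos t)" "(p * cos s + q * sin s)\<^sup>2 = (sin (t - s))\<^sup>2"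
proof -
  define w where "w = p * sin t - q * cos t"
  have sc: "sin t * sin t + cos t * cos t = 1" using sin_cos_squared_add[of t] by (simp add: power2_eq_square)
  have rot: "p * (s * s + c * c) = (p * s - q * c) * s + (p * c + q * s) * c"
    "q * (s * s + c * c) = - (p * s - q * c) * c + (p * c + q * s) * s" for s c :: real
    by (simp_all add: algebra_simps)
  have "p = p * (sin t * sin t + cos t * cos t)" by (simp only: sc mult_1_right)
  also have "\<dots> = w * sin t + (p * cos t + q * sin t) * cos t" unfolding w_def by (rule rot)
  finally have p: "p = w * sin t" using bc by simp
  have "q = q * (sin t * sin t + cos t * cos t)" by (simp only: sc mult_1_right)
  also have "\<dots> = - w * cos t + (p * cos t + q * sin t) * sin t" unfolding w_def by (rule rot)
  finally have q: "q = - w * cos t" using bc by simp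
  have "w\<^sup>2 * (s * s + c * c) = (w * s)\<^sup>2 + (- w * c)\<^sup>2" for s c :: real
    by (simp add: power2_eq_square algebra_simps)
  from this[of "sin t" "cos t"] have "w\<^sup>2 * (sin t * sin t + cos t * cos t) = p\<^sup>2 + q\<^sup>2"
    by (simp only: p q)
  then have w: "w\<^sup>2 = 1" using unit sc by simp
  show "p\<^sup>2 = (sin t)\<^sup>2" using w by (simp add: p power_mult_distrib)
  show "p * q = - (sin t * cos t)" using w by (simp add: p q power2_eq_square)
  have "p * cos s + q * sin s = w * sin (t - s)"
    unfolding p q sin_diff by (simp add: algebra_simps)
  then show "(p * cos s + q * sin s)\<^sup>2 = (sin (t - s))\<^sup>2" using w by (simp add: power_mult_distrib)
qed

text \<open>A converse expressed through \<open>p\<^sup>2\<close> and the sign of \<open>p q\<close>, since these are what the spectral densities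
  determine: \<open>(p, q)\<close> itself is only known up to sign.\<close>

lemma unit_vector_has_angle:
  fixes p q :: real
  assumes unit: "p\<^sup>2 + q\<^sup>2 = 1" and neg: "p * q \<le> 0"
    and lo: "(sin \<alpha>)\<^sup>2 \<le> p\<^sup>2" and hi: "p\<^sup>2 < (sin \<beta>)\<^sup>2"
    and range: "0 \<le> \<alpha>" "\<alpha> \<le> pi / 2" "0 \<le> \<beta>" "\<beta> \<le> pi / 2"
  shows "\<exists>\<theta>\<in>{\<alpha>..<\<beta>}. p * cos \<theta> + q * sin \<theta> = 0"
proof -
  define \<theta> where "\<theta> = arcsin \<bar>p\<bar>"
  have "p\<^sup>2 \<le> 1" using unit zero_le_power2[of q] by linarith
  then have p1: "\<bar>p\<bar> \<le> 1" using abs_square_le_1[of p] by simp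
  then have s: "sin \<theta> = \<bar>p\<bar>" and th: "0 \<le> \<theta>" "\<theta> \<le> pi / 2"
    using arcsin_bounded[of "\<bar>p\<bar>"] arcsin_le_arcsin[of 0 "\<bar>p\<bar>"] by (auto simp: \<theta>_def)
  have "(cos \<theta>)\<^sup>2 = q\<^sup>2" using sin_cos_squared_add[of \<theta>] unit by (simp add: s)
  moreover have "cos \<theta> \<ge> 0" using th by (intro cos_ge_zero) auto
  ultimately have c: "cos \<theta> = \<bar>q\<bar>"
    using real_sqrt_abs[of "cos \<theta>"] real_sqrt_abs[of q] by simp
  have "p * \<bar>q\<bar> + q * \<bar>p\<bar> = 0" using neg by (auto simp: abs_if mult_le_0_iff)
  then have eq: "p * cos \<theta> + q * sin \<theta> = 0" by (simp add: s c)
  have "\<alpha> \<le> \<theta>"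
  proof (rule ccontr)
    assume "\<not> \<alpha> \<le> \<theta>"
    then have "sin \<theta> < sin \<alpha>" using th range by (intro sin_monotone_2pi) auto
    then have "\<bar>p\<bar>\<^sup>2 < (sin \<alpha>)\<^sup>2" unfolding s by (intro power_strict_mono) auto
    then show False using lo by simp
  qed
  moreover have "\<theta> < \<beta>"
  proof (rule ccontr)
    assume "\<not> \<theta> < \<beta>"
    then have "sin \<beta> \<le> sin \<theta>" using th range by (intro sin_monotone_2pi_le) auto
    moreover have "0 \<le> sin \<beta>" using range pi_gt_zero by (intro sin_ge_zero) auto
    ultimately have "(sin \<beta>)\<^sup>2 \<le> \<bar>p\<bar>\<^sup>2" unfolding s by (intro power_mono) auto
    then show False using hi by simp
  qed
  ultimately show ?thesis using eq by auto
qed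

text \<open>Pairing with this vector evaluates the boundary form \<open>u(0) c + u(1) d\<close>.\<close>

definition boundary_vector :: "real \<Rightarrow> real \<Rightarrow> ell2"
  where "boundary_vector c d = of_real c *\<^sub>C delta 0 + of_real d *\<^sub>C delta 1"

lemma cinner_boundary_vector:
  "cinner \<eta> (boundary_vector c d) = coord \<eta> 0 * of_real c + coord \<eta> 1 * of_real d"
  by (simp add: boundary_vector_def cinner_add_right cinner_scale_right cinner_delta mult.commute)

lemma coord_boundary_vector:
  "coord (boundary_vector c d) n = (if n = 0 then of_real c else if n = 1 then of_real d else 0)"
  by (simp add: boundary_vector_def plus_ell2.rep_eq scaleC.rep_eq coord_delta)


section \<open>Spectral densities on the set of subordinate energies\<close>

context spectral_pair
begin

lemma sets_mu_trace [simp]: "sets (mu_trace P) = sets borel"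
  unfolding mu_trace_def using sets.sigma_sets_eq[of "borel :: real measure"]
  by (simp add: sets_measure_of)

lemma emeasure_mu_trace:
  assumes "B \<in> sets borel"
  shows "emeasure (mu_trace P) B = emeasure (spec_meas P (delta 0)) B + emeasure (spec_meas P (delta 1)) B"
  unfolding mu_trace_def
proof (rule emeasure_measure_of_sigma[where \<Omega> = UNIV and M = "sets borel"])
  let ?f = "\<lambda>B. emeasure (spec_meas P (delta 0)) B + emeasure (spec_meas P (delta 1)) B"
  show "sigma_algebra UNIV (sets (borel :: real measure))"
    using sets.sigma_algebra_axioms[of "borel :: real measure"] by simp
  show "positive (sets borel) ?f" by (simp add: positive_def)
  show "countably_additive (sets borel) ?f"
  proof (rule countably_additiveI)
    fix A :: "nat \<Rightarrow> real set" assume "range A \<subseteq> sets borel" "disjoint_family A"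
    then show "(\<Sum>n. ?f (A n)) = ?f (\<Union> (range A))"
      by (subst suminf_add[symmetric]) (auto simp: suminf_emeasure)
  qed
qed (rule assms)

lemma finite_mu_trace: "finite_measure (mu_trace P)"
proof (rule finite_measureI)
  have "space (mu_trace P) = UNIV" using sets_eq_imp_space_eq[OF sets_mu_trace] by simp
  then show "emeasure (mu_trace P) (space (mu_trace P)) \<noteq> \<infinity>"
    by (simp add: emeasure_mu_trace emeasure_spec_meas)
qed

lemma measure_mu_trace:
  "B \<in> sets borel \<Longrightarrow> measure (mu_trace P) B = (norm (P B (delta 0)))\<^sup>2 + (norm (P B (delta 1)))\<^sup>2"
  by (simp add: measure_def emeasure_mu_trace emeasure_spec_meas flip: ennreal_plus)

lemma norm_P_boundary_vector:
  assumes B: "B \<in> sets borel"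
  shows "complex_of_real ((norm (P B (boundary_vector c d)))\<^sup>2) =
    of_real (c * c) * mu_entry P 0 0 B + of_real (c * d) * mu_entry P 0 1 B
    + of_real (d * c) * mu_entry P 1 0 B + of_real (d * d) * mu_entry P 1 1 B"
proof -
  have "complex_of_real ((norm (P B (boundary_vector c d)))\<^sup>2)
      = cinner (P B (boundary_vector c d)) (boundary_vector c d)"
    unfolding cinner_self[symmetric] using P_self_adjoint[OF B] P_idem[OF B] by metis
  also have "\<dots> = of_real (c * c) * mu_entry P 0 0 B + of_real (c * d) * mu_entry P 0 1 B
    + of_real (d * c) * mu_entry P 1 0 B + of_real (d * d) * mu_entry P 1 1 B"
    unfolding boundary_vector_def mu_entry_def P_add[OF B] P_scale[OF B]
      cinner_add_left cinner_add_right cinner_scale_left cinner_scale_right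
    by (simp add: algebra_simps)
  finally show ?thesis .
qed

definition boundary_density :: "real \<Rightarrow> real \<Rightarrow> real \<Rightarrow> real \<Rightarrow> real"
  where "boundary_density c d \<epsilon> E =
    measure (spec_meas P (boundary_vector c d)) {E - \<epsilon><..<E + \<epsilon>} / measure (mu_trace P) {E - \<epsilon><..<E + \<epsilon>}"

lemma boundary_density_measurable [measurable]:
  "boundary_density c d \<epsilon> \<in> borel_measurable borel"
  unfolding boundary_density_def
  by (intro borel_measurable_divide borel_measurable_measure_interval finite_spec_meas finite_mu_trace) simp_all

text \<open>Expanding \<open>\<parallel>P(I) \<chi>\<parallel>\<^sup>2\<close> in the entries \<open>\<mu>\<^sub>k\<^sub>j(I)\<close> with \<open>k, j\<close> in \<open>{0, 1}\<close>, whose ratios to \<open>\<mu>(I)\<close> tend to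
  \<open>u(k) u(j)\<close>, gives a perfect square in the limit.\<close>

lemma admissible_density:
  assumes adm: "admissible_support a b P S" and E: "E \<in> S"
  obtains u :: "int \<Rightarrow> real" where "subordinate a b E (\<lambda>n. of_real (u n))" "(u 0)\<^sup>2 + (u 1)\<^sup>2 = 1"
    "\<And>c d. ((\<lambda>\<epsilon>. boundary_density c d \<epsilon> E) \<longlongrightarrow> (u 0 * c + u 1 * d)\<^sup>2) (at_right 0)"
proof -
  obtain u :: "int \<Rightarrow> real" where u: "subordinate a b E (\<lambda>n. of_real (u n))" "\<bar>u 0\<bar>\<^sup>2 + \<bar>u 1\<bar>\<^sup>2 = 1"
    and lim: "\<And>k j. ((\<lambda>\<epsilon>. mu_entry P k j {E - \<epsilon><..<E + \<epsilon>} /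
                 of_real (measure (mu_trace P) {E - \<epsilon><..<E + \<epsilon>})) \<longlongrightarrow> of_real (u k * u j)) (at_right 0)"
    using adm E unfolding admissible_support_def by blast
  show thesis
  proof (rule that)
    show "subordinate a b E (\<lambda>n. of_real (u n))" "(u 0)\<^sup>2 + (u 1)\<^sup>2 = 1" using u by simp_all
    fix c d
    let ?I = "\<lambda>\<epsilon>. {E - \<epsilon><..<E + \<epsilon>}"
    let ?q = "\<lambda>k j \<epsilon>. mu_entry P k j (?I \<epsilon>) / of_real (measure (mu_trace P) (?I \<epsilon>))"
    have "((\<lambda>\<epsilon>. of_real (c * c) * ?q 0 0 \<epsilon> + of_real (c * d) * ?q 0 1 \<epsilon>
        + of_real (d * c) * ?q 1 0 \<epsilon> + of_real (d * d) * ?q 1 1 \<epsilon>) \<longlongrightarrow>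
        of_real (c * c) * of_real (u 0 * u 0) + of_real (c * d) * of_real (u 0 * u 1)
        + of_real (d * c) * of_real (u 1 * u 0) + of_real (d * d) * of_real (u 1 * u 1)) (at_right 0)"
      by (intro tendsto_intros lim)
    also have "(\<lambda>\<epsilon>. of_real (c * c) * ?q 0 0 \<epsilon> + of_real (c * d) * ?q 0 1 \<epsilon>
        + of_real (d * c) * ?q 1 0 \<epsilon> + of_real (d * d) * ?q 1 1 \<epsilon>)
        = (\<lambda>\<epsilon>. complex_of_real (boundary_density c d \<epsilon> E))"
    proof
      fix \<epsilon>
      have "complex_of_real (boundary_density c d \<epsilon> E)
          = of_real ((norm (P (?I \<epsilon>) (boundary_vector c d)))\<^sup>2) / of_real (measure (mu_trace P) (?I \<epsilon>))"
        by (simp add: boundary_density_def measure_spec_meas)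
      then show "of_real (c * c) * ?q 0 0 \<epsilon> + of_real (c * d) * ?q 0 1 \<epsilon>
        + of_real (d * c) * ?q 1 0 \<epsilon> + of_real (d * d) * ?q 1 1 \<epsilon> = complex_of_real (boundary_density c d \<epsilon> E)"
        by (subst (asm) norm_P_boundary_vector) (simp_all only: add_divide_distrib times_divide_eq_right sets.top borel_open open_greaterThanLessThan)
    qed
    also have "of_real (c * c) * of_real (u 0 * u 0) + of_real (c * d) * of_real (u 0 * u 1)
        + of_real (d * c) * of_real (u 1 * u 0) + of_real (d * d) * of_real (u 1 * u 1)
        = complex_of_real ((u 0 * c + u 1 * d)\<^sup>2)"
      by (simp add: power2_eq_square algebra_simps)
    finally show "((\<lambda>\<epsilon>. boundary_density c d \<epsilon> E) \<longlongrightarrow> (u 0 * c + u 1 * d)\<^sup>2) (at_right 0)"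
      by (simp only: tendsto_of_real_iff)
  qed
qed

text \<open>On the admissible set, the squares of the boundary forms of \<open>u\<^sub>E\<close> are limits of Borel functions of \<open>E\<close>.
  Two of them decide whether the angle of \<open>u\<^sub>E\<close> lies in \<open>[\<alpha>, \<beta>)\<close>: \<open>u\<^sub>E(0)\<^sup>2\<close> fixes the angle up to the
  sign of \<open>u\<^sub>E(0) u\<^sub>E(1)\<close>, and \<open>(u\<^sub>E(0) + u\<^sub>E(1))\<^sup>2 \<le> 1\<close> fixes that sign. The result
  matters because \<open>P\<close> is constrained on Borel sets only.\<close>

lemma S_part_borel:
  assumes a: "\<And>n. a n > 0" and adm: "admissible_support a b P S"
    and range: "0 < \<alpha>" "\<alpha> < \<beta>" "\<beta> < pi / 2"
  shows "S_part a b S {\<alpha>..<\<beta>} \<in> sets borel"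
proof -
  define \<rho> where "\<rho> c d E = lim (\<lambda>n. boundary_density c d (1 / real (Suc n)) E)" for c d E
  have [measurable]: "\<rho> c d \<in> borel_measurable borel" for c d
    unfolding \<rho>_def by measurable
  have S: "S \<in> sets borel" using adm by (simp add: admissible_support_def)
  have "S_part a b S {\<alpha>..<\<beta>} = S \<inter> {E. (sin \<alpha>)\<^sup>2 \<le> \<rho> 1 0 E \<and> \<rho> 1 0 E < (sin \<beta>)\<^sup>2 \<and> \<rho> 1 1 E \<le> 1}"
  proof (rule set_eqI)
    fix E
    show "E \<in> S_part a b S {\<alpha>..<\<beta>} \<longleftrightarrow> E \<in> S \<inter> {E. (sin \<alpha>)\<^sup>2 \<le> \<rho> 1 0 E \<and> \<rho> 1 0 E < (sin \<beta>)\<^sup>2 \<and> \<rho> 1 1 E \<le> 1}"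
    proof (cases "E \<in> S")
      case True
      obtain u :: "int \<Rightarrow> real" where u: "subordinate a b E (\<lambda>n. of_real (u n))" and unit: "(u 0)\<^sup>2 + (u 1)\<^sup>2 = 1"
        and lim: "\<And>c d. ((\<lambda>\<epsilon>. boundary_density c d \<epsilon> E) \<longlongrightarrow> (u 0 * c + u 1 * d)\<^sup>2) (at_right 0)"
        using admissible_density[OF adm True] by blast
      have \<rho>: "\<rho> c d E = (u 0 * c + u 1 * d)\<^sup>2" for c d
      proof -
        have "filterlim (\<lambda>n. 1 / real (Suc n)) (at_right 0) sequentially"
          unfolding filterlim_at using LIMSEQ_inverse_real_of_nat
          by (simp add: divide_inverse)
        from filterlim_compose[OF lim this] show ?thesis
          unfolding \<rho>_def by (rule limI)
      qed
      have "(\<exists>\<theta>\<in>{\<alpha>..<\<beta>}. u 0 * cos \<theta> + u 1 * sin \<theta> = 0) \<longleftrightarrow>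
          (sin \<alpha>)\<^sup>2 \<le> (u 0)\<^sup>2 \<and> (u 0)\<^sup>2 < (sin \<beta>)\<^sup>2 \<and> u 0 * u 1 \<le> 0" (is "?lhs \<longleftrightarrow> ?rhs")
      proof
        assume ?lhs
        then obtain \<theta> where \<theta>: "\<alpha> \<le> \<theta>" "\<theta> < \<beta>" "u 0 * cos \<theta> + u 1 * sin \<theta> = 0" by auto
        have "sin \<alpha> \<le> sin \<theta>" "sin \<theta> < sin \<beta>"
          using \<theta> range by (intro sin_monotone_2pi_le sin_monotone_2pi; simp)+
        moreover have pos: "0 \<le> sin \<alpha>" "0 \<le> sin \<theta>" "0 \<le> cos \<theta>"
          using \<theta> range by (intro sin_ge_zero cos_ge_zero; simp)+
        ultimately have "(sin \<alpha>)\<^sup>2 \<le> (sin \<theta>)\<^sup>2" "(sin \<theta>)\<^sup>2 < (sin \<beta>)\<^sup>2"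
          by (intro power_mono power_strict_mono; simp)+
        with unit_vector_angle(1,2)[OF unit \<theta>(3)] pos show ?rhs by simp
      next
        assume ?rhs
        then show ?lhs using unit range by (intro unit_vector_has_angle) auto
      qed
      moreover have "(u 0 + u 1)\<^sup>2 \<le> 1 \<longleftrightarrow> u 0 * u 1 \<le> 0" using unit by (simp add: power2_sum mult.commute)
      ultimately show ?thesis
        using True sub_set_theta_iff[OF a u] by (simp add: S_part_def \<rho>)
    qed (simp add: S_part_def)
  qed
  also have "\<dots> \<in> sets borel"
    by (intro sets.Int S) measurable
  finally show ?thesis .
qed

text \<open>At an energy whose subordinate solution has the angle \<open>\<theta>'\<close>, the spectral measure of the boundary
  vector at angle \<open>\<theta>\<close> has density \<open>sin\<^sup>2 (\<theta>' - \<theta>) < (\<beta> - \<alpha>)\<^sup>2\<close> with respect to \<open>\<mu>\<close>, as a limit over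
  shrinking intervals. The total mass of \<open>\<mu>\<close> is at most 2, and the passage from intervals to the set costs
  a further factor 2.\<close>

lemma norm_P_boundary_vector_le:
  assumes a: "\<And>n. a n > 0" and adm: "admissible_support a b P S"
    and range: "0 < \<alpha>" "\<beta> < pi / 2" and \<theta>: "\<theta> \<in> {\<alpha>..<\<beta>}"
  shows "norm (P (S_part a b S {\<alpha>..<\<beta>}) (boundary_vector (cos \<theta>) (sin \<theta>))) \<le> 2 * (\<beta> - \<alpha>)"
proof -
  let ?A = "S_part a b S {\<alpha>..<\<beta>}" and ?\<chi> = "boundary_vector (cos \<theta>) (sin \<theta>)"
  have \<alpha>\<beta>: "\<alpha> < \<beta>" using \<theta> by simp
  have A: "?A \<in> sets borel" by (rule S_part_borel[OF a adm range(1) \<alpha>\<beta> range(2)])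
  have "measure (spec_meas P ?\<chi>) ?A \<le> 2 * (\<beta> - \<alpha>)\<^sup>2 * measure (mu_trace P) ?A"
  proof (rule measure_le_by_interval_differentiation)
    fix E \<delta> :: real assume E: "E \<in> ?A" and \<delta>: "\<delta> > 0"
    obtain \<theta>' where \<theta>': "\<theta>' \<in> {\<alpha>..<\<beta>}" "E \<in> sub_set_theta a b \<theta>'" and ES: "E \<in> S"
      using E by (auto simp: S_part_def)
    obtain u :: "int \<Rightarrow> real" where u: "subordinate a b E (\<lambda>n. of_real (u n))" and unit: "(u 0)\<^sup>2 + (u 1)\<^sup>2 = 1"
      and lim: "\<And>c d. ((\<lambda>\<epsilon>. boundary_density c d \<epsilon> E) \<longlongrightarrow> (u 0 * c + u 1 * d)\<^sup>2) (at_right 0)"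
      using admissible_density[OF adm ES] by blast
    have bc: "u 0 * cos \<theta>' + u 1 * sin \<theta>' = 0"
      using sub_set_theta_iff[OF a u] \<theta>'(2) by simp
    have "(u 0 * cos \<theta> + u 1 * sin \<theta>)\<^sup>2 = (sin (\<theta>' - \<theta>))\<^sup>2" by (rule unit_vector_angle(3)[OF unit bc])
    also have "\<dots> < (\<beta> - \<alpha>)\<^sup>2"
    proof -
      have "\<bar>sin (\<theta>' - \<theta>)\<bar> \<le> \<bar>\<theta>' - \<theta>\<bar>" by (rule abs_sin_x_le_abs_x)
      also have "\<dots> < \<beta> - \<alpha>" using \<theta> \<theta>'(1) by auto
      finally have "\<bar>sin (\<theta>' - \<theta>)\<bar>\<^sup>2 < (\<beta> - \<alpha>)\<^sup>2" by (intro power_strict_mono) auto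
      then show ?thesis by simp
    qed
    finally have "\<forall>\<^sub>F \<epsilon> in at_right 0. boundary_density (cos \<theta>) (sin \<theta>) \<epsilon> E < (\<beta> - \<alpha>)\<^sup>2"
      by (rule order_tendstoD(2)[OF lim])
    moreover have "\<forall>\<^sub>F \<epsilon> in at_right 0. \<epsilon> < \<delta>" by (rule order_tendstoD(2)[OF tendsto_ident_at \<delta>])
    ultimately have "\<forall>\<^sub>F \<epsilon> in at_right 0. 0 < \<epsilon> \<and> \<epsilon> < \<delta> \<and> boundary_density (cos \<theta>) (sin \<theta>) \<epsilon> E < (\<beta> - \<alpha>)\<^sup>2"
      using eventually_at_right_less[of 0] by eventually_elim simp
    then obtain \<epsilon> where \<epsilon>: "0 < \<epsilon>" "\<epsilon> < \<delta>" "boundary_density (cos \<theta>) (sin \<theta>) \<epsilon> E < (\<beta> - \<alpha>)\<^sup>2"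
      using eventually_happens'[OF trivial_limit_at_right_real] by blast
    let ?I = "{E - \<epsilon><..<E + \<epsilon>}"
    have "measure (spec_meas P ?\<chi>) ?I \<le> (\<beta> - \<alpha>)\<^sup>2 * measure (mu_trace P) ?I"
    proof (cases "measure (mu_trace P) ?I = 0")
      \<comment> \<open>here the difference quotient is the default value 0, but \<open>P ?I\<close> kills \<open>\<delta>\<^sub>0\<close> and \<open>\<delta>\<^sub>1\<close>\<close>
      case True
      then have "P ?I (delta 0) = 0" "P ?I (delta 1) = 0"
        by (simp_all add: measure_mu_trace add_nonneg_eq_0_iff)
      then have "P ?I ?\<chi> = 0" by (simp add: boundary_vector_def P_add P_scale)
      then show ?thesis by (simp add: measure_spec_meas True)
    next
      case False
      then have "measure (mu_trace P) ?I > 0" by (simp add: zero_less_measure_iff)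
      then show ?thesis using \<epsilon>(3) by (simp add: boundary_density_def divide_less_eq)
    qed
    then show "\<exists>\<epsilon>. 0 < \<epsilon> \<and> \<epsilon> < \<delta> \<and> measure (spec_meas P ?\<chi>) {E - \<epsilon><..<E + \<epsilon>} \<le> (\<beta> - \<alpha>)\<^sup>2 * measure (mu_trace P) {E - \<epsilon><..<E + \<epsilon>}"
      using \<epsilon>(1,2) by blast
  qed (simp_all add: finite_mu_trace finite_spec_meas A)
  also have "\<dots> \<le> 2 * (\<beta> - \<alpha>)\<^sup>2 * 2"
  proof (rule mult_left_mono)
    have "(norm (P ?A (delta k)))\<^sup>2 \<le> 1" for k
      using norm_P_le[OF A, of "delta k"] by (simp add: power_le_one)
    from add_mono[OF this[of 0] this[of 1]] show "measure (mu_trace P) ?A \<le> 2"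
      by (simp add: measure_mu_trace A)
  qed simp
  also have "\<dots> = (2 * (\<beta> - \<alpha>))\<^sup>2" unfolding power_mult_distrib by simp
  finally have "(norm (P ?A ?\<chi>))\<^sup>2 \<le> (2 * (\<beta> - \<alpha>))\<^sup>2"
    by (simp only: measure_spec_meas A)
  then show ?thesis using \<alpha>\<beta> by (simp add: power2_le_iff_abs_le)
qed

lemma T_bounded: "\<exists>R\<ge>0. \<forall>\<eta>. norm (T \<eta>) \<le> R * norm \<eta>"
proof -
  obtain C where "C \<ge> 0" "\<And>x. cmod (cut of_real x) \<le> C"
    using bdd_borel_cut_id by (rule bdd_borelE) blast
  then show ?thesis
    by (intro exI[of _ "4 * C"]) (auto simp: T_eq_calc intro!: norm_calc_le[OF bdd_borel_cut_id])
qed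

end


section \<open>The operators with a boundary condition\<close>

text \<open>Cutting the line between the sites 0 and 1 is a rank-one perturbation, and the boundary form of
  \<open>\<eta>\<close> at the angle \<open>\<theta>\<close> factors out of it.\<close>

lemma jacobi_theta_difference:
  assumes bdd: "bounded (range a)" "bounded (range b)" and \<theta>: "\<theta> \<in> {0<..<pi / 2}"
  shows "jacobi_theta a b \<theta> \<eta> - jacobi_op a b \<eta> =
    (- of_real (a 0) * cinner \<eta> (boundary_vector (cos \<theta>) (sin \<theta>))) *\<^sub>C boundary_vector (1 / sin \<theta>) (1 / cos \<theta>)"
proof (rule ell2_eqI)
  fix n :: int
  have nz: "sin \<theta> \<noteq> 0" "cos \<theta> \<noteq> 0"
    using \<theta> sin_gt_zero[of \<theta>] cos_gt_zero[of \<theta>] by auto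
  have coords: "coord (x + y) n = coord x n + coord y n" "coord (c *\<^sub>C x) n = c * coord x n"
    "coord (restrict_to A x) n = (if n \<in> A then coord x n else 0)" for x y c A n
    by (simp_all add: plus_ell2.rep_eq scaleC.rep_eq restrict_to.rep_eq)
  consider "n < 0" | "n = 0" | "n = 1" | "n > 1" by linarith
  then show "coord (jacobi_theta a b \<theta> \<eta> - jacobi_op a b \<eta>) n =
      coord ((- of_real (a 0) * cinner \<eta> (boundary_vector (cos \<theta>) (sin \<theta>))) *\<^sub>C boundary_vector (1 / sin \<theta>) (1 / cos \<theta>)) n"
    using nz
    by cases
      (simp_all add: jacobi_theta_def coords coord_diff coord_jacobi_op[OF bdd] jacobi_expr_def
        cinner_boundary_vector coord_boundary_vector cinner_delta coord_delta cot_def tan_def field_simps)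
qed

lemma norm_boundary_vector_le: "norm (boundary_vector c d) \<le> \<bar>c\<bar> + \<bar>d\<bar>"
  unfolding boundary_vector_def by (rule norm_triangle_le) (simp add: norm_scaleC)


lemma jacobi_theta_close:
  assumes bdd: "bounded (range a)" "bounded (range b)" and a0: "a 0 > 0"
    and lo: "0 < lo" and \<theta>: "lo \<le> \<theta>" "\<theta> \<le> hi" and hi: "hi < pi / 2"
  shows "norm (jacobi_theta a b \<theta> \<eta> - jacobi_op a b \<eta>) \<le>
    a 0 * (1 / sin lo + 1 / cos hi) * cmod (cinner \<eta> (boundary_vector (cos \<theta>) (sin \<theta>)))"
proof -
  have "sin lo > 0" "sin lo \<le> sin \<theta>" "cos hi > 0" "cos hi \<le> cos \<theta>"
    using lo \<theta> hi by (auto intro!: sin_gt_zero cos_gt_zero sin_monotone_2pi_le cos_monotone_0_pi_le)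
  then have "\<bar>1 / sin \<theta>\<bar> + \<bar>1 / cos \<theta>\<bar> \<le> 1 / sin lo + 1 / cos hi"
    by (intro add_mono) (simp_all add: frac_le)
  then have "norm (boundary_vector (1 / sin \<theta>) (1 / cos \<theta>)) \<le> 1 / sin lo + 1 / cos hi"
    using norm_boundary_vector_le order_trans by blast
  then have "a 0 * cmod (cinner \<eta> (boundary_vector (cos \<theta>) (sin \<theta>))) * norm (boundary_vector (1 / sin \<theta>) (1 / cos \<theta>))
      \<le> a 0 * cmod (cinner \<eta> (boundary_vector (cos \<theta>) (sin \<theta>))) * (1 / sin lo + 1 / cos hi)"
    using a0 by (intro mult_left_mono) auto
  moreover have "\<theta> \<in> {0<..<pi / 2}" using lo \<theta> hi by auto
  ultimately show ?thesis
    using a0 by (simp add: jacobi_theta_difference[OF bdd] norm_scaleC norm_mult mult_ac)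
qed


section \<open>The comparison of the Jacobi operators\<close>

theorem theorem4p3:
  fixes a b :: "int \<Rightarrow> real"
    and P :: "real set \<Rightarrow> ell2 \<Rightarrow> ell2"
    and P_theta :: "real \<Rightarrow> real set \<Rightarrow> ell2 \<Rightarrow> ell2"
    and S :: "real set"
    and lo hi :: real
    and F :: "real \<Rightarrow> complex"
  assumes "bounded (range a)" and "bounded (range b)" and "\<And>n. a n > 0"
    and "is_spectral_measure (jacobi_op a b) P"
    and "\<And>\<theta>. \<theta> \<in> {0<..<pi / 2} \<Longrightarrow> is_spectral_measure (jacobi_theta a b \<theta>) (P_theta \<theta>)"
    and "admissible_support a b P S"
    and "lo \<in> {0<..<pi / 2}" and "hi \<in> {0<..<pi / 2}"
    and "F \<in> test_funs"
  shows "\<exists>\<gamma>>0. \<forall>\<alpha> \<beta> \<psi> \<theta>.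
    lo \<le> \<alpha> \<and> \<alpha> < \<beta> \<and> \<beta> \<le> hi \<and> \<psi> \<in> H_plus \<and> \<theta> \<in> {\<alpha>..<\<beta>} \<longrightarrow>
    (let \<phi> = Q_meas a b P S {\<alpha>..<\<beta>} \<psi>;
         d = norm (functional_calculus (P_theta \<theta>) F \<phi> - functional_calculus P F \<phi>)
     in d \<le> \<gamma> * \<bar>\<beta> - \<alpha>\<bar> * norm \<phi> \<and> (\<phi> \<noteq> 0 \<longrightarrow> d < \<gamma> * \<bar>\<beta> - \<alpha>\<bar> * norm \<phi>))"
proof -
  let ?J = "jacobi_op a b" and ?J\<theta> = "jacobi_theta a b"
  note a = assms(3) and adm = assms(6)
  interpret J: spectral_pair ?J P by standard (rule assms(4))
  obtain R0 where R0: "R0 \<ge> 0" "\<And>\<eta>. norm (?J \<eta>) \<le> R0 * norm \<eta>" using J.T_bounded by blast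
  define m where "m = a 0 * (1 / sin lo + 1 / cos hi)"
  have "sin lo > 0" "cos hi > 0"
    using assms(7,8) by (auto intro!: sin_gt_zero cos_gt_zero)
  then have m: "m > 0" using a[of 0] by (simp add: m_def add_pos_pos)
  have close: "norm (?J\<theta> \<theta> \<eta> - ?J \<eta>) \<le> m * cmod (cinner \<eta> (boundary_vector (cos \<theta>) (sin \<theta>)))"
    if "lo \<le> \<theta>" "\<theta> \<le> hi" for \<theta> \<eta>
    unfolding m_def using assms(7,8) that by (intro jacobi_theta_close assms(1,2) a) auto
  \<comment> \<open>a norm bound common to \<open>J\<close> and all \<open>J\<^sub>\<theta>\<close>, since the boundary vectors have norm at most 2\<close>
  define R where "R = R0 + 2 * m"
  have R: "R \<ge> 0" using R0(1) m by (simp add: R_def)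
  have J_bound: "norm (?J \<eta>) \<le> R * norm \<eta>" for \<eta>
    using R0(2)[of \<eta>] m by (simp add: R_def algebra_simps) (smt (verit) mult_nonneg_nonneg norm_ge_zero)
  have J\<theta>_bound: "norm (?J\<theta> \<theta> \<eta>) \<le> R * norm \<eta>" if "lo \<le> \<theta>" "\<theta> \<le> hi" for \<theta> \<eta>
  proof -
    let ?\<chi> = "boundary_vector (cos \<theta>) (sin \<theta>)"
    have "norm ?\<chi> \<le> 2"
      using norm_boundary_vector_le[of "cos \<theta>" "sin \<theta>"] abs_cos_le_one[of \<theta>] abs_sin_le_one[of \<theta>] by linarith
    then have "cmod (cinner \<eta> ?\<chi>) \<le> norm \<eta> * 2"
      using cinner_cauchy_schwarz[of \<eta> ?\<chi>] mult_left_mono[OF _ norm_ge_zero, of "norm ?\<chi>" 2 \<eta>] by linarith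
    then have "m * cmod (cinner \<eta> ?\<chi>) \<le> m * (norm \<eta> * 2)" using m by (intro mult_left_mono) auto
    moreover have "norm (?J\<theta> \<theta> \<eta>) \<le> norm (?J \<eta>) + norm (?J\<theta> \<theta> \<eta> - ?J \<eta>)"
      by (rule norm_triangle_sub)
    ultimately show ?thesis
      using close[OF that, of \<eta>] R0(2)[of \<eta>] by (simp add: R_def algebra_simps)
  qed
  obtain g where g: "g \<ge> 0" and diff: "\<And>T P T' P' A \<kappa> \<phi>. spectral_perturbation T P T' P' A R \<kappa> \<Longrightarrow> P A \<phi> = \<phi> \<Longrightarrow>
    norm (functional_calculus P' F \<phi> - functional_calculus P F \<phi>) \<le> g * \<kappa> * norm \<phi>"
    using test_fun_difference[OF assms(9) R] by blast
  \<comment> \<open>the summand 1 makes the inequality strict for nonzero vectors\<close>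
  define \<gamma> where "\<gamma> = 2 * g * m + 1"
  have bound: "norm (functional_calculus (P_theta \<theta>) F \<phi> - functional_calculus P F \<phi>) \<le> 2 * g * m * (\<beta> - \<alpha>) * norm \<phi>"
    if range: "lo \<le> \<alpha>" "\<alpha> < \<beta>" "\<beta> \<le> hi" and \<theta>: "\<theta> \<in> {\<alpha>..<\<beta>}" and \<phi>: "\<phi> = Q_meas a b P S {\<alpha>..<\<beta>} \<psi>"
    for \<alpha> \<beta> \<psi> \<theta> \<phi>
  proof -
    let ?A = "S_part a b S {\<alpha>..<\<beta>}" and ?\<chi> = "boundary_vector (cos \<theta>) (sin \<theta>)"
    have range': "0 < \<alpha>" "\<beta> < pi / 2" and \<theta>': "lo \<le> \<theta>" "\<theta> \<le> hi" "\<theta> \<in> {0<..<pi / 2}"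
      using range \<theta> assms(7,8) by auto
    have A: "?A \<in> sets borel" by (rule J.S_part_borel[OF a adm range'(1) range(2) range'(2)])
    have \<chi>: "norm (P ?A ?\<chi>) \<le> 2 * (\<beta> - \<alpha>)" by (rule J.norm_P_boundary_vector_le[OF a adm range' \<theta>])
    have "spectral_perturbation ?J P (?J\<theta> \<theta>) (P_theta \<theta>) ?A R (2 * m * (\<beta> - \<alpha>))"
    proof (unfold_locales)
      show "is_spectral_measure (?J\<theta> \<theta>) (P_theta \<theta>)" by (rule assms(5)[OF \<theta>'(3)])
      show "?A \<in> sets borel" "0 \<le> R" by (rule A R)+
      show "0 \<le> 2 * m * (\<beta> - \<alpha>)" using m range(2) by simp
      show "norm (?J \<eta>) \<le> R * norm \<eta>" "norm (?J\<theta> \<theta> \<eta>) \<le> R * norm \<eta>" for \<eta>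
        using J_bound J\<theta>_bound[OF \<theta>'(1,2)] by blast+
      fix \<eta> assume \<eta>: "P ?A \<eta> = \<eta>"
      \<comment> \<open>on the range of \<open>P ?A\<close> only the projection of the boundary vector is seen\<close>
      have "cmod (cinner \<eta> ?\<chi>) = cmod (cinner \<eta> (P ?A ?\<chi>))"
        using J.P_self_adjoint[OF A, of \<eta> ?\<chi>] by (simp add: \<eta>)
      also have "\<dots> \<le> norm \<eta> * norm (P ?A ?\<chi>)" by (rule cinner_cauchy_schwarz)
      also have "\<dots> \<le> norm \<eta> * (2 * (\<beta> - \<alpha>))" by (rule mult_left_mono[OF \<chi> norm_ge_zero])
      finally have "m * cmod (cinner \<eta> ?\<chi>) \<le> m * (norm \<eta> * (2 * (\<beta> - \<alpha>)))"
        using m by (intro mult_left_mono) auto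
      with close[OF \<theta>'(1,2), of \<eta>] show "norm (?J\<theta> \<theta> \<eta> - ?J \<eta>) \<le> 2 * m * (\<beta> - \<alpha>) * norm \<eta>"
        by (simp add: mult_ac)
    qed
    moreover have "P ?A \<phi> = \<phi>" unfolding \<phi> Q_meas_def by (rule J.P_idem[OF A])
    ultimately show ?thesis using diff by (fastforce simp: mult_ac)
  qed
  show ?thesis
  proof (intro exI[of _ \<gamma>] conjI allI impI)
    show "\<gamma> > 0" using g m by (simp add: \<gamma>_def add_nonneg_pos)
    fix \<alpha> \<beta> \<psi> \<theta>
    assume *: "lo \<le> \<alpha> \<and> \<alpha> < \<beta> \<and> \<beta> \<le> hi \<and> \<psi> \<in> H_plus \<and> \<theta> \<in> {\<alpha>..<\<beta>}"
    define \<phi> where "\<phi> = Q_meas a b P S {\<alpha>..<\<beta>} \<psi>"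
    define d where "d = norm (functional_calculus (P_theta \<theta>) F \<phi> - functional_calculus P F \<phi>)"
    have "d \<le> 2 * g * m * (\<beta> - \<alpha>) * norm \<phi>"
      unfolding d_def using * by (intro bound) (auto simp: \<phi>_def)
    moreover have "\<gamma> * \<bar>\<beta> - \<alpha>\<bar> * norm \<phi> = 2 * g * m * (\<beta> - \<alpha>) * norm \<phi> + (\<beta> - \<alpha>) * norm \<phi>"
      using * by (simp add: \<gamma>_def algebra_simps)
    moreover have "(\<beta> - \<alpha>) * norm \<phi> \<ge> 0" "\<phi> \<noteq> 0 \<Longrightarrow> (\<beta> - \<alpha>) * norm \<phi> > 0"
      using * by auto
    ultimately have "d \<le> \<gamma> * \<bar>\<beta> - \<alpha>\<bar> * norm \<phi> \<and> (\<phi> \<noteq> 0 \<longrightarrow> d < \<gamma> * \<bar>\<beta> - \<alpha>\<bar> * norm \<phi>)"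
      by auto
    then show "let \<phi> = Q_meas a b P S {\<alpha>..<\<beta>} \<psi>;
         d = norm (functional_calculus (P_theta \<theta>) F \<phi> - functional_calculus P F \<phi>)
     in d \<le> \<gamma> * \<bar>\<beta> - \<alpha>\<bar> * norm \<phi> \<and> (\<phi> \<noteq> 0 \<longrightarrow> d < \<gamma> * \<bar>\<beta> - \<alpha>\<bar> * norm \<phi>)"
      by (simp add: Let_def \<phi>_def d_def)
  qed
qed

end
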